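(* Let $k_1,k_2,k_3\in\mathbb{R}$ and $N\ge1$. The periodic multi-peakon solutions of $$m_t+k_1[(u^2-u_x^2)m]_x+k_2(u^2m_x+3uu_xm)+k_3(um_x+2u_xm)=0,\qquad m=u-u_{xx},$$ in the weak periodic sense defined in the context, are given by $$u_{pm}(t,x)=\sum_{i=1}^Np_i(t)\cosh\left(\frac12-(x-q_i(t))+\lfloor x-q_i(t)\rfloor\right),$$ where $\lfloor\cdot\rfloor$ is the floor function; that is, such a function is a weak solution on $[0,T)$ whenever the positions $q_i(t)$, with $0<q_1(t)<q_2(t)<\cdots<q_N(t)<1$, and amplitudes $p_i(t)$ are continuously differentiable functions on $[0,T)$ satisfying, with $\xi_{jm}:=q_j-q_m$, the dynamical system $$\begin{aligned}\dot p_m=\;&\frac{k_2p_m}{2\sinh(1/2)}\bigg\{\frac12\sum_{j\ne m}p_j\,\mathrm{sgn}(\xi_{jm})\Big[p_m\big(\cosh(1/2+|\xi_{jm}|)-\cosh(3/2-|\xi_{jm}|)\big)\\&\quad+p_j\big(\cosh(1/2-2|\xi_{jm}|)-\cosh(3/2-2|\xi_{jm}|)\big)\Big]+2\sinh(1/2)\sum_{j<m<k}p_jp_k\sinh(\xi_{jm}+\xi_{km})\\&\quad+\Big(\sum_{m<j<k}-\sum_{j<k<m}\Big)p_jp_k\big(\cosh(1/2-|\xi_{jm}|-|\xi_{km}|)-\cosh(3/2-|\xi_{jm}|-|\xi_{km}|)\big)\bigg\}\\&+\frac{k_3p_m}{2\sinh(1/2)}\sum_{j=1}^Np_j\,\mathrm{sgn}(\xi_{jm})\big(\cosh(|\xi_{jm}|)-\cosh(1-|\xi_{jm}|)\big),\end{aligned}$$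 $$\begin{aligned}\dot q_m=\;&\Big[\Big(\frac{2k_1}{3}+k_2\Big)\sinh^2(1/2)+\frac{k_2}{2}\Big]p_m^2+\frac{(k_1+k_2)p_m}{2\sinh(1/2)}\sum_{j\ne m}p_j\big(\sinh(1/2+|\xi_{jm}|)+\sinh(3/2-|\xi_{jm}|)\big)\\&+\frac{2k_1+k_2}{2\sinh(1/2)}\bigg\{\sum_{j<m<k}p_jp_k\big(\sinh(3/2+\xi_{jm}-\xi_{km})-\sinh(1/2+\xi_{jm}-\xi_{km})\big)\\&\quad+\sinh(1/2)\Big[\sum_{i=1}^Np_i^2+2\Big(\sum_{m<j<k}+\sum_{j<k<m}\Big)p_jp_k\cosh(\xi_{jm}-\xi_{km})\Big]\bigg\}\\&+\frac{k_2}{2\sinh(1/2)}\bigg\{\sum_{j\ne m}\frac{p_j^2}{2}\big(\sinh(3/2-2|\xi_{jm}|)-\sinh(1/2-2|\xi_{jm}|)\big)+2\sinh(1/2)\sum_{j<m<k}p_jp_k\cosh(\xi_{jm}+\xi_{km})\\&\quad+\Big(\sum_{m<j<k}+\sum_{j<k<m}\Big)p_jp_k\big(\sinh(3/2-|\xi_{km}|-|\xi_{jm}|)-\sinh(1/2-|\xi_{km}|-|\xi_{jm}|)\big)\bigg\}\\&+\frac{k_3}{2\sinh(1/2)}\sum_{j=1}^Np_j\big(\sinh(|\xi_{jm}|)+\sinh(1-|\xi_{jm}|)\big)\end{aligned}$$ for $m=1,2,\dots,N$.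
   Context: In the dynamical system, $m$ denotes an index in $\{1,\dots,N\}$; sums such as $\sum_{j<m<k}$ run over indices $j,k\in\{1,\dots,N\}$ subject to the indicated order with $m$ fixed, and $\mathrm{sgn}(0)=0$. Let $\mathbb{S}=[0,1)$, with functions on $\mathbb{S}$ regarded as functions of period one in $x$, and let $G(x)=\frac{1}{2\sinh(1/2)}\cosh(x-\frac12)$ for $x\in[0,1)$, extended with period one; $*$ denotes periodic convolution in $x$ over $\mathbb{S}$. For $u_0\in W^{1,3}(\mathbb{S})$, a function $u\in L^\infty_{loc}([0,T),W^{1,3}(\mathbb{S}))$ is a weak solution of the periodic problem with initial datum $u_0$ (here $u_0=u_{pm}(0,\cdot)$) if $$\begin{aligned}&\int_0^T\!\!\int_{\mathbb{S}}\Big\{u\varphi_t+\tfrac{k_1+k_2}{3}u^3\varphi_x+\tfrac{k_1}{3}u_x^3\varphi+\tfrac{k_3}{2}u^2\varphi_x-G*\big[(\tfrac{k_1}{3}+\tfrac{k_2}{2})u_x^3\big]\varphi\\&\quad+G*\big[(\tfrac{2k_1}{3}+k_2)u^3+(k_1+\tfrac{3k_2}{2})uu_x^2+k_3u^2+\tfrac{k_3}{2}u_x^2\big]\varphi_x\Big\}dx\,dt+\int_{\mathbb{S}}u_0(x)\varphi(0,x)\,dx=0\end{aligned}$$ for every smooth test function $\varphi\in C_c^\infty([0,T)\times\mathbb{S})$. *)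

theory Defs
  imports "HOL-Analysis.Analysis"
begin

section \<open>Function spaces on the circle\<close>

text \<open>
  A function on the circle is represented by a function on \<open>real\<close> with period one; integrals
  over the circle are Lebesgue integrals over \<open>{0..<1}\<close>.
\<close>

definition periodic1 :: "(real \<Rightarrow> real) \<Rightarrow> bool" where
  "periodic1 f \<longleftrightarrow> (\<forall>x. f (x + 1) = f x)"

abbreviation circle :: "real measure" where
  "circle \<equiv> lebesgue_on {0..<1}"

primrec C_k :: "nat \<Rightarrow> ('a::real_normed_vector \<Rightarrow> 'b::real_normed_vector) \<Rightarrow> bool" where
  "C_k 0 f \<longleftrightarrow> continuous_on UNIV f"
| "C_k (Suc n) f \<longleftrightarrow>
     (\<forall>x. f differentiable (at x)) \<and> (\<forall>v. C_k n (\<lambda>x. frechet_derivative f (at x) v))"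

definition C_inf :: "('a::real_normed_vector \<Rightarrow> 'b::real_normed_vector) \<Rightarrow> bool" where
  "C_inf f \<longleftrightarrow> (\<forall>n. C_k n f)"

definition L3 :: "(real \<Rightarrow> real) set" where
  "L3 = {f. periodic1 f \<and> f \<in> borel_measurable circle \<and> integrable circle (\<lambda>x. \<bar>f x\<bar> ^ 3)}"

definition L3_norm :: "(real \<Rightarrow> real) \<Rightarrow> real" where
  "L3_norm f = root 3 (LINT x|circle. \<bar>f x\<bar> ^ 3)"

definition has_weak_deriv :: "(real \<Rightarrow> real) \<Rightarrow> (real \<Rightarrow> real) \<Rightarrow> bool" where
  "has_weak_deriv f g \<longleftrightarrow>
     (\<forall>\<psi>. C_inf \<psi> \<and> periodic1 \<psi> \<longrightarrow>
        (LINT x|circle. f x * deriv \<psi> x) = - (LINT x|circle. g x * \<psi> x))"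

definition W13 :: "(real \<Rightarrow> real) set" where
  "W13 = {f. f \<in> L3 \<and> (\<exists>g\<in>L3. has_weak_deriv f g)}"

definition time_interval :: "ereal \<Rightarrow> real set" where
  "time_interval T = {t. 0 \<le> t \<and> ereal t < T}"

text \<open>
  \<open>Linf_loc_W13 T u v\<close>: \<open>u\<close> is of class \<open>L\<^sup>\<infinity>\<^sub>l\<^sub>o\<^sub>c([0,T), W\<^sup>1\<^sup>,\<^sup>3)\<close> with spatial weak derivative \<open>v\<close>
  (which is determined by \<open>u\<close> almost everywhere).  Joint measurability expresses
  strong measurability of the maps \<open>t \<mapsto> u t\<close> and \<open>t \<mapsto> v t\<close> into the separable space \<open>L\<^sup>3\<close>.
\<close>

definition Linf_loc_W13 ::
    "ereal \<Rightarrow> (real \<Rightarrow> real \<Rightarrow> real) \<Rightarrow> (real \<Rightarrow> real \<Rightarrow> real) \<Rightarrow> bool" where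
  "Linf_loc_W13 T u v \<longleftrightarrow>
     (\<lambda>(t, x). u t x) \<in> borel_measurable (lebesgue_on (time_interval T \<times> UNIV)) \<and>
     (\<lambda>(t, x). v t x) \<in> borel_measurable (lebesgue_on (time_interval T \<times> UNIV)) \<and>
     (AE t in lebesgue_on (time_interval T). u t \<in> L3 \<and> v t \<in> L3 \<and> has_weak_deriv (u t) (v t)) \<and>
     (\<forall>\<tau>\<in>time_interval T. \<exists>C. AE t in lebesgue_on {0..\<tau>}. L3_norm (u t) + L3_norm (v t) \<le> C)"

section \<open>Weak solutions\<close>

definition G :: "real \<Rightarrow> real" where
  "G x = cosh (frac x - 1/2) / (2 * sinh (1/2))"

definition conv :: "(real \<Rightarrow> real) \<Rightarrow> (real \<Rightarrow> real) \<Rightarrow> real \<Rightarrow> real" where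
  "conv f g x = (LINT y|circle. f (x - y) * g y)"

text \<open>
  Test functions of class \<open>C\<^sub>c\<^sup>\<infinity>\<close> on \<open>[0,T)\<close> times the circle.  Smoothness up to the boundary
  \<open>t = 0\<close> is expressed by extension to negative times, where the values are irrelevant.
\<close>

definition test_functions :: "ereal \<Rightarrow> (real \<times> real \<Rightarrow> real) set" where
  "test_functions T = {\<phi>. C_inf \<phi> \<and> (\<forall>t. periodic1 (\<lambda>x. \<phi> (t, x))) \<and>
     (\<exists>\<tau>\<in>time_interval T. \<forall>t x. \<tau> < t \<longrightarrow> \<phi> (t, x) = 0)}"

definition weak_solution ::
    "real \<Rightarrow> real \<Rightarrow> real \<Rightarrow> ereal \<Rightarrow> (real \<Rightarrow> real) \<Rightarrow> (real \<Rightarrow> real \<Rightarrow> real) \<Rightarrow> bool" where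
  "weak_solution k1 k2 k3 T u0 u \<longleftrightarrow>
     u0 \<in> W13 \<and>
     (\<exists>v. Linf_loc_W13 T u v \<and>
       (\<forall>\<phi>\<in>test_functions T.
          (LINT t|lebesgue_on (time_interval T). LINT x|circle.
              u t x * deriv (\<lambda>s. \<phi> (s, x)) t
            + (k1 + k2) / 3 * (u t x) ^ 3 * deriv (\<lambda>y. \<phi> (t, y)) x
            + k1 / 3 * (v t x) ^ 3 * \<phi> (t, x)
            + k3 / 2 * (u t x) ^ 2 * deriv (\<lambda>y. \<phi> (t, y)) x
            - conv G (\<lambda>y. (k1 / 3 + k2 / 2) * (v t y) ^ 3) x * \<phi> (t, x)
            + conv G (\<lambda>y. (2 * k1 / 3 + k2) * (u t y) ^ 3
                        + (k1 + 3 * k2 / 2) * u t y * (v t y) ^ 2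
                        + k3 * (u t y) ^ 2 + k3 / 2 * (v t y) ^ 2) x
                * deriv (\<lambda>y. \<phi> (t, y)) x)
          + (LINT x|circle. u0 x * \<phi> (0, x)) = 0))"

section \<open>Periodic multi-peakons\<close>

definition multipeakon ::
    "nat \<Rightarrow> (nat \<Rightarrow> real \<Rightarrow> real) \<Rightarrow> (nat \<Rightarrow> real \<Rightarrow> real) \<Rightarrow> real \<Rightarrow> real \<Rightarrow> real" where
  "multipeakon N p q t x =
     (\<Sum>i=1..N. p i t * cosh (1/2 - (x - q i t) + of_int \<lfloor>x - q i t\<rfloor>))"

definition pairs_around :: "nat \<Rightarrow> nat \<Rightarrow> (nat \<times> nat) set" where
  "pairs_around N m = {(j, k). j \<in> {1..N} \<and> k \<in> {1..N} \<and> j < m \<and> m < k}"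

definition pairs_above :: "nat \<Rightarrow> nat \<Rightarrow> (nat \<times> nat) set" where
  "pairs_above N m = {(j, k). j \<in> {1..N} \<and> k \<in> {1..N} \<and> m < j \<and> j < k}"

definition pairs_below :: "nat \<Rightarrow> nat \<Rightarrow> (nat \<times> nat) set" where
  "pairs_below N m = {(j, k). j \<in> {1..N} \<and> k \<in> {1..N} \<and> j < k \<and> k < m}"

definition p_rhs ::
    "real \<Rightarrow> real \<Rightarrow> nat \<Rightarrow> (nat \<Rightarrow> real) \<Rightarrow> (nat \<Rightarrow> real) \<Rightarrow> nat \<Rightarrow> real" where
  "p_rhs k2 k3 N p q m =
    (let \<xi> = (\<lambda>j. q j - q m);
         h = (\<lambda>(j, k). p j * p k * (cosh (1/2 - \<bar>\<xi> j\<bar> - \<bar>\<xi> k\<bar>) - cosh (3/2 - \<bar>\<xi> j\<bar> - \<bar>\<xi> k\<bar>)))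
     in
       k2 * p m / (2 * sinh (1/2)) *
         ( 1/2 * (\<Sum>j\<in>{1..N} - {m}. p j * sgn (\<xi> j) *
              ( p m * (cosh (1/2 + \<bar>\<xi> j\<bar>) - cosh (3/2 - \<bar>\<xi> j\<bar>))
              + p j * (cosh (1/2 - 2 * \<bar>\<xi> j\<bar>) - cosh (3/2 - 2 * \<bar>\<xi> j\<bar>))))
         + 2 * sinh (1/2) * (\<Sum>(j, k)\<in>pairs_around N m. p j * p k * sinh (\<xi> j + \<xi> k))
         + (sum h (pairs_above N m) - sum h (pairs_below N m)))
     + k3 * p m / (2 * sinh (1/2)) *
         (\<Sum>j=1..N. p j * sgn (\<xi> j) * (cosh \<bar>\<xi> j\<bar> - cosh (1 - \<bar>\<xi> j\<bar>))))"

definition q_rhs ::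
    "real \<Rightarrow> real \<Rightarrow> real \<Rightarrow> nat \<Rightarrow> (nat \<Rightarrow> real) \<Rightarrow> (nat \<Rightarrow> real) \<Rightarrow> nat \<Rightarrow> real" where
  "q_rhs k1 k2 k3 N p q m =
    (let \<xi> = (\<lambda>j. q j - q m);
         g = (\<lambda>(j, k). p j * p k * cosh (\<xi> j - \<xi> k));
         h = (\<lambda>(j, k). p j * p k * (sinh (3/2 - \<bar>\<xi> k\<bar> - \<bar>\<xi> j\<bar>) - sinh (1/2 - \<bar>\<xi> k\<bar> - \<bar>\<xi> j\<bar>)))
     in
       ((2 * k1 / 3 + k2) * (sinh (1/2)) ^ 2 + k2 / 2) * (p m) ^ 2
     + (k1 + k2) * p m / (2 * sinh (1/2)) *
         (\<Sum>j\<in>{1..N} - {m}. p j * (sinh (1/2 + \<bar>\<xi> j\<bar>) + sinh (3/2 - \<bar>\<xi> j\<bar>)))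
     + (2 * k1 + k2) / (2 * sinh (1/2)) *
         ( (\<Sum>(j, k)\<in>pairs_around N m.
              p j * p k * (sinh (3/2 + \<xi> j - \<xi> k) - sinh (1/2 + \<xi> j - \<xi> k)))
         + sinh (1/2) *
             ((\<Sum>i=1..N. (p i) ^ 2) + 2 * (sum g (pairs_above N m) + sum g (pairs_below N m))))
     + k2 / (2 * sinh (1/2)) *
         ( (\<Sum>j\<in>{1..N} - {m}. (p j) ^ 2 / 2 * (sinh (3/2 - 2 * \<bar>\<xi> j\<bar>) - sinh (1/2 - 2 * \<bar>\<xi> j\<bar>)))
         + 2 * sinh (1/2) * (\<Sum>(j, k)\<in>pairs_around N m. p j * p k * cosh (\<xi> j + \<xi> k))
         + (sum h (pairs_above N m) + sum h (pairs_below N m)))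
     + k3 / (2 * sinh (1/2)) *
         (\<Sum>j=1..N. p j * (sinh \<bar>\<xi> j\<bar> + sinh (1 - \<bar>\<xi> j\<bar>))))"

end

theory Submission
  imports Defs
begin

text \<open>
  Write \<open>u\<close> for the multi-peakon and \<open>v\<close> for its spatial slope.  Two observations carry the proof.

  The first is that the lengthy dynamical system is a disguise of two short equations.  With
  \<open>U = u(q\<^sub>m)\<close> and \<open>W\<close> the mean of the two one-sided slopes at \<open>q\<^sub>m\<close>, it reads
  \<open>p\<^sub>m' = - p\<^sub>m W (k\<^sub>2 U + k\<^sub>3)\<close> and
  \<open>q\<^sub>m' = (k\<^sub>1 + k\<^sub>2) U\<^sup>2 + k\<^sub>3 U - k\<^sub>1 W\<^sup>2 - (k\<^sub>1/3) (sinh (1/2) p\<^sub>m)\<^sup>2\<close>; the double sums are what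
  appears when the products \<open>U\<^sup>2\<close>, \<open>U W\<close>, \<open>W\<^sup>2\<close> are multiplied out and sorted by the position of the
  two indices relative to \<open>m\<close> (\<open>peakon_system_closed_form\<close>).

  The second is that convolution with \<open>G\<close> inverts \<open>1 - \<partial>\<^sub>x\<^sup>2\<close>, so it can be moved onto the test
  function.  Fix a time and let \<open>\<psi>\<close> be the spatial slice of the test function; then \<open>w = G * \<psi>\<close>
  solves \<open>w - w'' = \<psi>\<close>.  By Fubini and the evenness of \<open>G\<close> (\<open>conv_G_duality\<close>) the nonlocal terms of
  the weak form become integrals of polynomials in \<open>u\<close>, \<open>v\<close> against \<open>w\<close> and \<open>w'\<close>.  Between
  consecutive peaks \<open>u'' = u\<close>, and there the whole integrand is the derivative of the explicit
  expression \<open>-A(u)(w - \<psi>) + B(u,v) w' + S(u,v) w\<close>.  Hence its integral over the circle is minus the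
  sum of the jumps of this expression at the peaks, and by the closed form of the system those jumps
  are exactly \<open>2 sinh (1/2) (p\<^sub>m' w(q\<^sub>m) + p\<^sub>m q\<^sub>m' w'(q\<^sub>m))\<close>, up to sign
  (\<open>multipeakon_elliptic_identity\<close>).

  On the other hand \<open>u = 2 sinh (1/2) \<Sum>\<^sub>m p\<^sub>m G(x - q\<^sub>m)\<close>, so the pairing of \<open>u\<close> with \<open>\<phi>(t, \<cdot>)\<close> is
  \<open>2 sinh (1/2) \<Sum>\<^sub>m p\<^sub>m w(t, q\<^sub>m)\<close>.  Since \<open>w\<close> is as smooth as \<open>\<phi>\<close>, this is differentiable in time
  without any discussion of the moving corners of \<open>u\<close>, and by the jump formula its derivative is the
  spatial integral in the weak formulation (\<open>spatial_weak_form\<close>).  Integrating in time over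
  \<open>[0,T)\<close>, where \<open>\<phi>\<close> has compact support, leaves only the initial term
  (\<open>integral_time_interval\<close>).
\<close>

section \<open>The dynamical system in closed form\<close>

lemma sum_pairs_distrib:
  fixes F H :: "'a \<Rightarrow> 'b \<Rightarrow> real"
  shows "(\<Sum>(j, k)\<in>X. F j k + H j k) = (\<Sum>(j, k)\<in>X. F j k) + (\<Sum>(j, k)\<in>X. H j k)"
    and "(\<Sum>(j, k)\<in>X. F j k - H j k) = (\<Sum>(j, k)\<in>X. F j k) - (\<Sum>(j, k)\<in>X. H j k)"
    and "(\<Sum>(j, k)\<in>X. c * F j k) = c * (\<Sum>(j, k)\<in>X. F j k)"
  unfolding sum.distrib[symmetric] sum_subtractf[symmetric] sum_distrib_left
  by (auto intro!: sum.cong)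

text \<open>
  The square \<open>D \<times> D\<close> splits into its diagonal and two triangles, and one triangle is reflected onto
  the other; this is how sums over ordered pairs enter the dynamical system.
\<close>

lemma sum_mult_sum_ordered:
  fixes f g :: "nat \<Rightarrow> real"
  assumes "finite D"
  shows "sum f D * sum g D = (\<Sum>j\<in>D. f j * g j) +
     (\<Sum>(j, k)\<in>{(j, k). j \<in> D \<and> k \<in> D \<and> j < k}. f j * g k + g j * f k)"
proof -
  let ?T = "{(j, k). j \<in> D \<and> k \<in> D \<and> j < k}"
  let ?E = "(\<lambda>j. (j, j)) ` D" and ?S = "(\<lambda>(j, k). (k, j)) ` ?T"
  have fT: "finite ?T"
    by (rule finite_subset[of _ "D \<times> D"]) (use assms in auto)
  have DD: "D \<times> D = (?E \<union> ?T) \<union> ?S"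
    by (auto simp: image_iff)
  have "sum f D * sum g D = (\<Sum>(j, k)\<in>D \<times> D. f j * g k)"
    by (simp add: sum_product sum.cartesian_product)
  also have "\<dots> = (\<Sum>(j, k)\<in>?E. f j * g k) + (\<Sum>(j, k)\<in>?T. f j * g k) + (\<Sum>(j, k)\<in>?S. f j * g k)"
    unfolding DD by (subst sum.union_disjoint, use assms fT in \<open>auto\<close>)+
  also have "(\<Sum>(j, k)\<in>?E. f j * g k) = (\<Sum>j\<in>D. f j * g j)"
    by (subst sum.reindex) (auto simp: inj_on_def)
  also have "(\<Sum>(j, k)\<in>?S. f j * g k) = (\<Sum>(j, k)\<in>?T. g j * f k)"
    by (subst sum.reindex) (auto simp: inj_on_def intro!: sum.cong)
  finally show ?thesis
    by (simp add: sum_pairs_distrib)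
qed

text \<open>
  Every hyperbolic coefficient of the dynamical system is a polynomial in \<open>cosh (1/2 - a)\<close> and
  \<open>sinh (1/2 - a)\<close>, where \<open>a\<close> is the distance to the \<open>m\<close>-th peak: these are the contributions of a
  peak at distance \<open>a\<close> to the height and, up to sign, to the slope of the wave.
\<close>

lemma half_angle_identities:
  fixes a b :: real
  shows "cosh (1/2 - a - b) - cosh (3/2 - a - b) =
           - 2 * sinh (1/2) * (sinh (1/2 - a) * cosh (1/2 - b) + cosh (1/2 - a) * sinh (1/2 - b))"
    and "sinh (3/2 - a - b) - sinh (1/2 - a - b) =
           2 * sinh (1/2) * (cosh (1/2 - a) * cosh (1/2 - b) + sinh (1/2 - a) * sinh (1/2 - b))"
    and "cosh (1/2 + a) - cosh (3/2 - a) = - 4 * sinh (1/2) * cosh (1/2) * sinh (1/2 - a)"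
    and "sinh (1/2 + a) + sinh (3/2 - a) = 4 * sinh (1/2) * cosh (1/2) * cosh (1/2 - a)"
    and "cosh a - cosh (1 - a) = - 2 * sinh (1/2) * sinh (1/2 - a)"
    and "sinh a + sinh (1 - a) = 2 * sinh (1/2) * cosh (1/2 - a)"
    and "cosh (a - b) = cosh (1/2 - a) * cosh (1/2 - b) - sinh (1/2 - a) * sinh (1/2 - b)"
    and "sinh (a - b) = cosh (1/2 - a) * sinh (1/2 - b) - sinh (1/2 - a) * cosh (1/2 - b)"
proof -
  have 1: "cosh ((x + y) - h) - cosh ((x + y) + h) = - 2 * sinh h * (sinh x * cosh y + cosh x * sinh y)"
      "sinh ((x + y) + h) - sinh ((x + y) - h) = 2 * sinh h * (cosh x * cosh y + sinh x * sinh y)"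
      "cosh ((h + h) - x) - cosh ((h + h) + x) = - 4 * sinh h * cosh h * sinh x"
      "sinh ((h + h) - x) + sinh ((h + h) + x) = 4 * sinh h * cosh h * cosh x"
      "cosh (h - x) - cosh (h + x) = - 2 * sinh h * sinh x"
      "sinh (h - x) + sinh (h + x) = 2 * sinh h * cosh x"
      "cosh (y - x) = cosh x * cosh y - sinh x * sinh y"
      "sinh (y - x) = cosh x * sinh y - sinh x * cosh y" for h x y :: real
    by (simp_all only: cosh_add cosh_diff sinh_add sinh_diff) algebra+
  show "cosh (1/2 - a - b) - cosh (3/2 - a - b) =
           - 2 * sinh (1/2) * (sinh (1/2 - a) * cosh (1/2 - b) + cosh (1/2 - a) * sinh (1/2 - b))"
    using 1(1)[of "1/2 - a" "1/2 - b" "1/2"] by (simp add: algebra_simps)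
  show "sinh (3/2 - a - b) - sinh (1/2 - a - b) =
           2 * sinh (1/2) * (cosh (1/2 - a) * cosh (1/2 - b) + sinh (1/2 - a) * sinh (1/2 - b))"
    using 1(2)[of "1/2 - a" "1/2 - b" "1/2"] by (simp add: algebra_simps)
  show "cosh (1/2 + a) - cosh (3/2 - a) = - 4 * sinh (1/2) * cosh (1/2) * sinh (1/2 - a)"
    using 1(3)[of "1/2" "1/2 - a"] by simp
  show "sinh (1/2 + a) + sinh (3/2 - a) = 4 * sinh (1/2) * cosh (1/2) * cosh (1/2 - a)"
    using 1(4)[of "1/2" "1/2 - a"] by simp
  show "cosh a - cosh (1 - a) = - 2 * sinh (1/2) * sinh (1/2 - a)"
    using 1(5)[of "1/2" "1/2 - a"] by simp
  show "sinh a + sinh (1 - a) = 2 * sinh (1/2) * cosh (1/2 - a)"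
    using 1(6)[of "1/2" "1/2 - a"] by simp
  show "cosh (a - b) = cosh (1/2 - a) * cosh (1/2 - b) - sinh (1/2 - a) * sinh (1/2 - b)"
    using 1(7)[of "1/2 - b" "1/2 - a"] by simp
  show "sinh (a - b) = cosh (1/2 - a) * sinh (1/2 - b) - sinh (1/2 - a) * cosh (1/2 - b)"
    using 1(8)[of "1/2 - b" "1/2 - a"] by simp
qed

text \<open>
  Here \<open>U\<close> is the height of the wave at the \<open>m\<close>-th peak and \<open>W\<close> the mean of its one-sided slopes
  there (see \<open>branch_at_peak\<close>).  With \<open>c\<close>, \<open>s\<close> the contributions of the peaks to the left (\<open>B\<close>) and
  to the right (\<open>A\<close>), \<open>U = c\<^sub>B + p\<^sub>m cosh (1/2) + c\<^sub>A\<close> and \<open>W = s\<^sub>A - s\<^sub>B\<close>.  The sums over pairs on one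
  side of \<open>m\<close>, corrected by the diagonal terms in the single sums, produce the squares and products
  of sums over one side, and the sums over pairs around \<open>m\<close> the mixed products.
\<close>

lemma peakon_system_closed_form:
  fixes p q :: "nat \<Rightarrow> real"
  assumes m: "m \<in> {1..N}" and sm: "strict_mono_on {1..N} q"
  defines "U \<equiv> (\<Sum>j=1..N. p j * cosh (1/2 - \<bar>q j - q m\<bar>))"
    and "W \<equiv> (\<Sum>j=1..N. p j * sgn (q j - q m) * sinh (1/2 - \<bar>q j - q m\<bar>))"
  shows "p_rhs k2 k3 N p q m = - p m * W * (k2 * U + k3)"
    and "q_rhs k1 k2 k3 N p q m =
           (k1 + k2) * U ^ 2 + k3 * U - k1 * W ^ 2 - k1 / 3 * (sinh (1/2) * p m) ^ 2"
proof -
  have ord: "q i < q j" if "1 \<le> i" "i < j" "j \<le> N" for i j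
    using strict_mono_onD[OF sm, of i j] that by auto
  define a where "a j = \<bar>q j - q m\<bar>" for j
  define c where "c j = p j * cosh (1/2 - a j)" for j
  define s where "s j = p j * sinh (1/2 - a j)" for j
  define C S :: real where "C = cosh (1/2)" and "S = sinh (1/2)"
  define B where "B = {1..<m}"
  define A where "A = {m<..N}"
  have fin: "finite A" "finite B" by (auto simp: A_def B_def)
  have S0: "S > 0" by (simp add: S_def)
  have CS: "C ^ 2 = 1 + S ^ 2" by (simp add: C_def S_def cosh_square_eq)
  have split: "sum f {1..N} = sum f B + f m + sum f A" for f :: "nat \<Rightarrow> real"
  proof -
    have "{1..N} = (B \<union> {m}) \<union> A" using m by (auto simp: A_def B_def)
    then show ?thesis
      by (simp only:) (subst sum.union_disjoint, auto simp: A_def B_def)+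
  qed
  have split': "sum f ({1..N} - {m}) = sum f B + sum f A" for f :: "nat \<Rightarrow> real"
    using split[of f] m by (simp add: sum_diff1)
  have qB: "q j - q m = - a j" "sgn (q j - q m) = -1" if "j \<in> B" for j
    using ord[of j m] that m by (auto simp: a_def B_def)
  have qA: "q j - q m = a j" "sgn (q j - q m) = 1" if "j \<in> A" for j
    using ord[of m j] that m by (auto simp: a_def A_def)
  have U: "U = sum c B + p m * C + sum c A"
    unfolding U_def split by (simp add: c_def a_def C_def)
  have W: "W = sum s A - sum s B"
  proof -
    have "(\<Sum>j\<in>A. p j * sgn (q j - q m) * sinh (1/2 - \<bar>q j - q m\<bar>)) = sum s A"
      unfolding a_def[symmetric] by (intro sum.cong refl) (simp add: qA(2) s_def)
    moreover have "(\<Sum>j\<in>B. p j * sgn (q j - q m) * sinh (1/2 - \<bar>q j - q m\<bar>)) = - sum s B"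
      unfolding a_def[symmetric] sum_negf[symmetric] by (intro sum.cong refl) (simp add: qB(2) s_def)
    ultimately show ?thesis unfolding W_def split by simp
  qed
  have ab: "pairs_above N m = {(j, k). j \<in> A \<and> k \<in> A \<and> j < k}"
    "pairs_below N m = {(j, k). j \<in> B \<and> k \<in> B \<and> j < k}"
    "pairs_around N m = B \<times> A"
    using m by (auto simp: pairs_above_def pairs_below_def pairs_around_def A_def B_def)
  let ?T = "\<lambda>D::nat set. {(j, k). j \<in> D \<and> k \<in> D \<and> j < k}"
  have T: "(\<Sum>(j, k)\<in>?T D. f j * g k + g j * f k) = sum f D * sum g D - (\<Sum>j\<in>D. f j * g j)"
    if "finite D" for D and f g :: "nat \<Rightarrow> real"
    using sum_mult_sum_ordered[OF that, of f g] by simp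
  have T2: "(\<Sum>(j, k)\<in>?T D. f j * f k) = ((sum f D) ^ 2 - (\<Sum>j\<in>D. f j ^ 2)) / 2"
    if "finite D" for D and f :: "nat \<Rightarrow> real"
    using T[OF that, of f f] by (simp add: sum_pairs_distrib power2_eq_square)
  have R: "(\<Sum>(j, k)\<in>B \<times> A. f j * g k) = sum f B * sum g A" for f g :: "nat \<Rightarrow> real"
    by (simp add: sum_product sum.cartesian_product)
  \<comment> \<open>the sums in the amplitude equation, as products of \<open>c\<close>-sums and \<open>s\<close>-sums\<close>
  have h1: "(\<Sum>(j, k)\<in>?T D. p j * p k * (cosh (1/2 - a j - a k) - cosh (3/2 - a j - a k)))
      = - 2 * S * (sum s D * sum c D - (\<Sum>j\<in>D. s j * c j))" if "finite D" for D
  proof -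
    have "(\<Sum>(j, k)\<in>?T D. p j * p k * (cosh (1/2 - a j - a k) - cosh (3/2 - a j - a k)))
      = (\<Sum>(j, k)\<in>?T D. - 2 * S * (s j * c k + c j * s k))"
      by (intro sum.cong refl) (simp only: half_angle_identities(1) s_def c_def S_def, auto simp: algebra_simps)
    also have "\<dots> = - 2 * S * (\<Sum>(j, k)\<in>?T D. s j * c k + c j * s k)"
      by (rule sum_pairs_distrib)
    finally show ?thesis using T[OF that, of s c] by simp
  qed
  have h2: "(\<Sum>(j, k)\<in>B \<times> A. p j * p k * sinh ((q j - q m) + (q k - q m)))
      = sum s B * sum c A - sum c B * sum s A"
  proof -
    have "(\<Sum>(j, k)\<in>B \<times> A. p j * p k * sinh ((q j - q m) + (q k - q m)))
       = (\<Sum>(j, k)\<in>B \<times> A. s j * c k - c j * s k)"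
    proof (intro sum.cong refl, clarify)
      fix j k assume jk: "j \<in> B" "k \<in> A"
      have "(q j - q m) + (q k - q m) = a k - a j" using qA(1)[OF jk(2)] qB(1)[OF jk(1)] by simp
      then show "p j * p k * sinh ((q j - q m) + (q k - q m)) = s j * c k - c j * s k"
        by (simp only: half_angle_identities(8)[of "a k" "a j"] s_def c_def) (simp add: algebra_simps)
    qed
    then show ?thesis using R[of s c] R[of c s] by (simp add: sum_pairs_distrib)
  qed
  have double: "cosh (1/2 - 2 * a j) - cosh (3/2 - 2 * a j) =
      - 4 * sinh (1/2) * sinh (1/2 - a j) * cosh (1/2 - a j)" for j
    using half_angle_identities(1)[of "a j" "a j"] by (simp add: algebra_simps)
  have h3: "(\<Sum>j\<in>B. p j * sgn (q j - q m) *
              ( p m * (cosh (1/2 + a j) - cosh (3/2 - a j))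
              + p j * (cosh (1/2 - 2 * a j) - cosh (3/2 - 2 * a j))))
       = 4 * S * (p m * C * sum s B + (\<Sum>j\<in>B. s j * c j))"
  proof -
    have "p j * sgn (q j - q m) *
              ( p m * (cosh (1/2 + a j) - cosh (3/2 - a j))
              + p j * (cosh (1/2 - 2 * a j) - cosh (3/2 - 2 * a j)))
          = 4 * S * (p m * C * s j + s j * c j)" if "j \<in> B" for j
      unfolding qB(2)[OF that] half_angle_identities(3) double
      by (simp add: s_def c_def C_def S_def algebra_simps)
    then show ?thesis by (simp add: sum.distrib sum_negf flip: sum_distrib_left)
  qed
  have h4: "(\<Sum>j\<in>A. p j * sgn (q j - q m) *
              ( p m * (cosh (1/2 + a j) - cosh (3/2 - a j))
              + p j * (cosh (1/2 - 2 * a j) - cosh (3/2 - 2 * a j))))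
       = - 4 * S * (p m * C * sum s A + (\<Sum>j\<in>A. s j * c j))"
  proof -
    have "p j * sgn (q j - q m) *
              ( p m * (cosh (1/2 + a j) - cosh (3/2 - a j))
              + p j * (cosh (1/2 - 2 * a j) - cosh (3/2 - 2 * a j)))
          = - 4 * S * (p m * C * s j + s j * c j)" if "j \<in> A" for j
      unfolding qA(2)[OF that] half_angle_identities(3) double
      by (simp add: s_def c_def C_def S_def algebra_simps)
    then show ?thesis by (simp add: sum.distrib sum_negf flip: sum_distrib_left)
  qed
  have h5: "(\<Sum>j=1..N. p j * sgn (q j - q m) * (cosh (a j) - cosh (1 - a j))) = - 2 * S * W"
    unfolding W_def a_def[symmetric] sum_distrib_left
    by (intro sum.cong refl) (simp only: half_angle_identities(5) S_def, simp add: algebra_simps)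
  show "p_rhs k2 k3 N p q m = - p m * W * (k2 * U + k3)"
    unfolding p_rhs_def Let_def ab split' a_def[symmetric] S_def[symmetric]
      h1[OF fin(1)] h1[OF fin(2)] h2 h3 h4 h5
    unfolding U W using S0 by (simp add: field_simps)
  \<comment> \<open>the same for the position equation; here the diagonal terms are sums of squares\<close>
  have g1: "(\<Sum>(j, k)\<in>?T D. p j * p k * (sinh (3/2 - a k - a j) - sinh (1/2 - a k - a j)))
      = S * ((sum c D) ^ 2 - (\<Sum>j\<in>D. c j ^ 2) + (sum s D) ^ 2 - (\<Sum>j\<in>D. s j ^ 2))" if "finite D" for D
  proof -
    have "(\<Sum>(j, k)\<in>?T D. p j * p k * (sinh (3/2 - a k - a j) - sinh (1/2 - a k - a j)))
      = (\<Sum>(j, k)\<in>?T D. 2 * S * (c j * c k + s j * s k))"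
      by (intro sum.cong refl) (simp only: half_angle_identities(2) s_def c_def S_def, auto simp: algebra_simps)
    also have "\<dots> = 2 * S * ((\<Sum>(j, k)\<in>?T D. c j * c k) + (\<Sum>(j, k)\<in>?T D. s j * s k))"
      by (simp only: sum_pairs_distrib)
    also have "\<dots> = S * ((sum c D) ^ 2 - (\<Sum>j\<in>D. c j ^ 2) + (sum s D) ^ 2 - (\<Sum>j\<in>D. s j ^ 2))"
      unfolding T2[OF that] by (simp add: field_simps)
    finally show ?thesis .
  qed
  have g2: "(\<Sum>(j, k)\<in>?T D. p j * p k * cosh ((q j - q m) - (q k - q m)))
      = ((sum c D) ^ 2 - (\<Sum>j\<in>D. c j ^ 2) - (sum s D) ^ 2 + (\<Sum>j\<in>D. s j ^ 2)) / 2"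
    if D: "finite D" "D = A \<or> D = B" for D
  proof -
    have "(\<Sum>(j, k)\<in>?T D. p j * p k * cosh ((q j - q m) - (q k - q m)))
       = (\<Sum>(j, k)\<in>?T D. c j * c k - s j * s k)"
    proof (intro sum.cong refl, clarify)
      fix j k assume jk: "j \<in> D" "k \<in> D"
      have "(q j - q m) - (q k - q m) = a j - a k \<or> (q j - q m) - (q k - q m) = a k - a j"
        using qA(1)[of j] qA(1)[of k] qB(1)[of j] qB(1)[of k] jk D(2) by auto
      then have "cosh ((q j - q m) - (q k - q m)) = cosh (a j - a k)"
        by (metis cosh_minus minus_diff_eq)
      then show "p j * p k * cosh ((q j - q m) - (q k - q m)) = c j * c k - s j * s k"
        by (simp only: half_angle_identities(7)[of "a j" "a k"] s_def c_def) (simp add: algebra_simps)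
    qed
    also have "\<dots> = (\<Sum>(j, k)\<in>?T D. c j * c k) - (\<Sum>(j, k)\<in>?T D. s j * s k)"
      by (rule sum_pairs_distrib)
    also have "\<dots> = ((sum c D) ^ 2 - (\<Sum>j\<in>D. c j ^ 2) - (sum s D) ^ 2 + (\<Sum>j\<in>D. s j ^ 2)) / 2"
      unfolding T2[OF D(1)] by (simp add: field_simps)
    finally show ?thesis .
  qed
  have g3: "(\<Sum>(j, k)\<in>B \<times> A. p j * p k * (sinh (3/2 + (q j - q m) - (q k - q m))
                 - sinh (1/2 + (q j - q m) - (q k - q m))))
      = 2 * S * (sum c B * sum c A + sum s B * sum s A)"
  proof -
    have "(\<Sum>(j, k)\<in>B \<times> A. p j * p k * (sinh (3/2 + (q j - q m) - (q k - q m))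
                 - sinh (1/2 + (q j - q m) - (q k - q m))))
       = (\<Sum>(j, k)\<in>B \<times> A. 2 * S * (c j * c k + s j * s k))"
    proof (intro sum.cong refl, clarify)
      fix j k assume jk: "j \<in> B" "k \<in> A"
      have e: "x + (q j - q m) - (q k - q m) = x - a j - a k" for x
        using qA(1)[OF jk(2)] qB(1)[OF jk(1)] by simp
      show "p j * p k * (sinh (3/2 + (q j - q m) - (q k - q m))
                 - sinh (1/2 + (q j - q m) - (q k - q m))) = 2 * S * (c j * c k + s j * s k)"
        unfolding e by (simp only: half_angle_identities(2) s_def c_def S_def) (simp add: algebra_simps)
    qed
    also have "\<dots> = 2 * S * ((\<Sum>(j, k)\<in>B \<times> A. c j * c k) + (\<Sum>(j, k)\<in>B \<times> A. s j * s k))"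
      by (simp only: sum_pairs_distrib)
    finally show ?thesis by (simp only: R)
  qed
  have g4: "(\<Sum>(j, k)\<in>B \<times> A. p j * p k * cosh ((q j - q m) + (q k - q m)))
      = sum c B * sum c A - sum s B * sum s A"
  proof -
    have "(\<Sum>(j, k)\<in>B \<times> A. p j * p k * cosh ((q j - q m) + (q k - q m)))
       = (\<Sum>(j, k)\<in>B \<times> A. c j * c k - s j * s k)"
    proof (intro sum.cong refl, clarify)
      fix j k assume jk: "j \<in> B" "k \<in> A"
      have "(q j - q m) + (q k - q m) = a k - a j" using qA(1)[OF jk(2)] qB(1)[OF jk(1)] by simp
      then show "p j * p k * cosh ((q j - q m) + (q k - q m)) = c j * c k - s j * s k"
        by (simp only: half_angle_identities(7)[of "a k" "a j"] s_def c_def) (simp add: algebra_simps)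
    qed
    then show ?thesis using R[of s s] R[of c c] by (simp add: sum_pairs_distrib)
  qed
  have g5: "(\<Sum>j\<in>D. p j * (sinh (1/2 + a j) + sinh (3/2 - a j))) = 4 * S * C * sum c D" for D
    unfolding sum_distrib_left
    by (intro sum.cong refl) (simp only: half_angle_identities(4) S_def C_def c_def, simp add: algebra_simps)
  have g6: "(\<Sum>j\<in>D. (p j) ^ 2 / 2 * (sinh (3/2 - 2 * a j) - sinh (1/2 - 2 * a j)))
      = S * ((\<Sum>j\<in>D. c j ^ 2) + (\<Sum>j\<in>D. s j ^ 2))" for D
  proof -
    have "(p j) ^ 2 / 2 * (sinh (3/2 - 2 * a j) - sinh (1/2 - 2 * a j)) = S * (c j ^ 2 + s j ^ 2)" for j
      using half_angle_identities(2)[of "a j" "a j"]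
      by (simp add: s_def c_def S_def power2_eq_square algebra_simps)
    then show ?thesis by (simp add: sum.distrib sum_negf flip: sum_distrib_left)
  qed
  have g7: "(\<Sum>j\<in>D. (p j) ^ 2) = (\<Sum>j\<in>D. c j ^ 2) - (\<Sum>j\<in>D. s j ^ 2)" for D
  proof -
    have "(p j) ^ 2 = c j ^ 2 - s j ^ 2" for j
      using hyperbolic_pythagoras[of "1/2 - a j"]
      by (simp add: s_def c_def power_mult_distrib flip: right_diff_distrib)
    then show ?thesis by (simp add: sum_subtractf)
  qed
  have g8: "(\<Sum>j=1..N. p j * (sinh (a j) + sinh (1 - a j))) = 2 * S * U"
    unfolding U_def a_def[symmetric] sum_distrib_left
    by (intro sum.cong refl) (simp only: half_angle_identities(6) S_def, simp add: algebra_simps)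
  have g9: "(\<Sum>i=1..N. (p i) ^ 2) = (\<Sum>j\<in>B. c j ^ 2) - (\<Sum>j\<in>B. s j ^ 2) + (p m) ^ 2
      + ((\<Sum>j\<in>A. c j ^ 2) - (\<Sum>j\<in>A. s j ^ 2))"
    by (subst split) (simp only: g7)
  define cA cB sA sB ccA ccB ssA ssB where "cA = sum c A" "cB = sum c B" "sA = sum s A" "sB = sum s B"
    "ccA = (\<Sum>j\<in>A. c j ^ 2)" "ccB = (\<Sum>j\<in>B. c j ^ 2)" "ssA = (\<Sum>j\<in>A. s j ^ 2)" "ssB = (\<Sum>j\<in>B. s j ^ 2)"
  note ds = this
  have "q_rhs k1 k2 k3 N p q m =
     ((2 * k1 / 3 + k2) * S ^ 2 + k2 / 2) * (p m) ^ 2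
     + (k1 + k2) * p m / (2 * S) * (4 * S * C * cB + 4 * S * C * cA)
     + (2 * k1 + k2) / (2 * S) * (2 * S * (cB * cA + sB * sA)
        + S * ((ccB - ssB + (p m) ^ 2 + (ccA - ssA))
          + 2 * ((cA ^ 2 - ccA - sA ^ 2 + ssA) / 2 + (cB ^ 2 - ccB - sB ^ 2 + ssB) / 2)))
     + k2 / (2 * S) * ((S * (ccB + ssB) + S * (ccA + ssA)) + 2 * S * (cB * cA - sB * sA)
        + (S * (cA ^ 2 - ccA + sA ^ 2 - ssA) + S * (cB ^ 2 - ccB + sB ^ 2 - ssB)))
     + k3 / (2 * S) * (2 * S * U)"
    unfolding q_rhs_def Let_def ab split' a_def[symmetric] S_def[symmetric]
      g1[OF fin(1)] g1[OF fin(2)] g2[OF fin(1) disjI1[OF refl]] g2[OF fin(2) disjI2[OF refl]]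
      g3 g4 g5 g6 g8 g9 ds ..
  also have "\<dots> = ((2 * k1 / 3 + k2) * S ^ 2 + k2 / 2) * (p m) ^ 2
     + (k1 + k2) * p m * (2 * C * cB + 2 * C * cA)
     + (2 * k1 + k2) / 2 * (2 * (cB * cA + sB * sA) + (p m) ^ 2
          + (cA ^ 2 - sA ^ 2 + cB ^ 2 - sB ^ 2))
     + k2 / 2 * (2 * (cB * cA - sB * sA) + cA ^ 2 + sA ^ 2 + cB ^ 2 + sB ^ 2)
     + k3 * U"
    using S0 by (simp add: field_simps)
  also have "\<dots> = (k1 + k2) * (cB + p m * C + cA) ^ 2 + k3 * U - k1 * (sA - sB) ^ 2 - k1 / 3 * (S * p m) ^ 2"
    by (simp add: power2_sum power2_diff power_mult_distrib CS field_simps)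
  finally show "q_rhs k1 k2 k3 N p q m =
           (k1 + k2) * U ^ 2 + k3 * U - k1 * W ^ 2 - k1 / 3 * (sinh (1/2) * p m) ^ 2"
    by (simp only: U W ds S_def)
qed

section \<open>The elliptic identity at a fixed time\<close>

text \<open>
  For an integrand whose primitive is given by a different smooth function on each piece of a
  partition, the telescoping sum of boundary terms leaves the two ends and the jumps.
\<close>

lemma has_integral_piecewise_ftc:
  fixes Q :: "nat \<Rightarrow> real" and P P' :: "nat \<Rightarrow> real \<Rightarrow> real"
  assumes "\<And>k. k \<le> N \<Longrightarrow> Q k \<le> Q (Suc k)"
    and "\<And>k x. k \<le> N \<Longrightarrow> (P k has_real_derivative P' k x) (at x)"
    and "\<And>k x. k \<le> N \<Longrightarrow> Q k < x \<Longrightarrow> x < Q (Suc k) \<Longrightarrow> h x = P' k x"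
  shows "(h has_integral (P N (Q (Suc N)) - P 0 (Q 0) - (\<Sum>k=1..N. P k (Q k) - P (k - 1) (Q k))))
           {Q 0..Q (Suc N)}"
  using assms
proof (induction N)
  case 0
  have "(P' 0 has_integral P 0 (Q (Suc 0)) - P 0 (Q 0)) {Q 0..Q (Suc 0)}"
    by (rule fundamental_theorem_of_calculus)
      (use 0 in \<open>auto simp: has_real_derivative_iff_has_vector_derivative[symmetric] intro: has_field_derivative_at_within\<close>)
  then have "(h has_integral P 0 (Q (Suc 0)) - P 0 (Q 0)) {Q 0..Q (Suc 0)}"
    by (rule has_integral_spike_finite[where f="P' 0" and S="{Q 0, Q (Suc 0)}", rotated 2])
      (use 0 in auto)
  then show ?case by simp
next
  case (Suc N)
  have IH: "(h has_integral (P N (Q (Suc N)) - P 0 (Q 0) - (\<Sum>k=1..N. P k (Q k) - P (k - 1) (Q k))))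
           {Q 0..Q (Suc N)}"
    by (rule Suc.IH) (use Suc.prems in auto)
  have "(P' (Suc N) has_integral P (Suc N) (Q (Suc (Suc N))) - P (Suc N) (Q (Suc N))) {Q (Suc N)..Q (Suc (Suc N))}"
    by (rule fundamental_theorem_of_calculus)
      (use Suc.prems in \<open>auto simp: has_real_derivative_iff_has_vector_derivative[symmetric] intro: has_field_derivative_at_within\<close>)
  then have 2: "(h has_integral P (Suc N) (Q (Suc (Suc N))) - P (Suc N) (Q (Suc N))) {Q (Suc N)..Q (Suc (Suc N))}"
    by (rule has_integral_spike_finite[where f="P' (Suc N)" and S="{Q (Suc N), Q (Suc (Suc N))}", rotated 2])
      (use Suc.prems in auto)
  have "Q 0 \<le> Q k" if "k \<le> Suc N" for k
    using that by (induction k) (auto intro: order_trans[OF _ Suc.prems(1)])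
  then have le: "Q 0 \<le> Q (Suc N)" by simp
  show ?case
    using has_integral_combine[OF le _ IH 2] Suc.prems(1)[of "Suc N"] by (simp add: algebra_simps)
qed

definition peaks :: "nat \<Rightarrow> (nat \<Rightarrow> real) \<Rightarrow> (nat \<Rightarrow> real) \<Rightarrow> real \<Rightarrow> real" where
  "peaks N p q x = (\<Sum>i=1..N. p i * cosh (1/2 - frac (x - q i)))"

definition slopes :: "nat \<Rightarrow> (nat \<Rightarrow> real) \<Rightarrow> (nat \<Rightarrow> real) \<Rightarrow> real \<Rightarrow> real" where
  "slopes N p q x = - (\<Sum>i=1..N. p i * sinh (1/2 - frac (x - q i)))"

text \<open>
  The entire function that agrees with the multi-peakon between the peaks \<open>k\<close> and \<open>k + 1\<close>,
  where \<open>0\<close> and \<open>1\<close> bound the first and the last interval: there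
  \<open>x - q i\<close> has integer part \<open>0\<close> for \<open>i \<le> k\<close> and \<open>-1\<close> for the later peaks.
\<close>

definition branch :: "nat \<Rightarrow> (nat \<Rightarrow> real) \<Rightarrow> (nat \<Rightarrow> real) \<Rightarrow> nat \<Rightarrow> real \<Rightarrow> real" where
  "branch N p q k x = (\<Sum>i=1..N. p i * cosh (1/2 - (x - q i) - (if i \<le> k then 0 else 1)))"

definition branch_slope :: "nat \<Rightarrow> (nat \<Rightarrow> real) \<Rightarrow> (nat \<Rightarrow> real) \<Rightarrow> nat \<Rightarrow> real \<Rightarrow> real" where
  "branch_slope N p q k x = - (\<Sum>i=1..N. p i * sinh (1/2 - (x - q i) - (if i \<le> k then 0 else 1)))"

lemma branch_derivatives:
  "(branch N p q k has_real_derivative branch_slope N p q k x) (at x)"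
  "(branch_slope N p q k has_real_derivative branch N p q k x) (at x)"
  unfolding branch_def[abs_def] branch_slope_def[abs_def]
  by (auto intro!: derivative_eq_intros sum.cong simp: sum_negf)

lemma branch_interior:
  assumes "\<And>i. i \<in> {1..N} \<Longrightarrow> 0 < q i \<and> q i < 1"
    and x: "0 < x" "x < 1"
    and "\<And>i. i \<in> {1..N} \<Longrightarrow> i \<le> k \<Longrightarrow> q i < x"
    and "\<And>i. i \<in> {1..N} \<Longrightarrow> k < i \<Longrightarrow> x < q i"
  shows "peaks N p q x = branch N p q k x" "slopes N p q x = branch_slope N p q k x"
proof -
  have "frac (x - q i) = (x - q i) + (if i \<le> k then 0 else 1)" if i: "i \<in> {1..N}" for i
  proof (cases "i \<le> k")
    case True
    then show ?thesis using assms(1)[OF i] assms(4)[OF i] x by (auto simp: frac_eq)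
  next
    case False
    have "frac (x - q i) = frac (x - q i + 1)" by (simp add: frac_1_eq)
    also have "\<dots> = x - q i + 1"
      using False assms(1)[OF i] assms(5)[OF i] x by (auto simp: frac_eq)
    finally show ?thesis using False by simp
  qed
  then have e: "1/2 - frac (x - q i) = 1/2 - (x - q i) - (if i \<le> k then 0 else 1)" if "i \<in> {1..N}" for i
    using that by simp
  show "peaks N p q x = branch N p q k x" "slopes N p q x = branch_slope N p q k x"
    unfolding peaks_def slopes_def branch_def branch_slope_def
    by (intro arg_cong[where f=uminus] sum.cong refl, simp only: e)+
qed

text \<open>
  The branches on both sides of a peak meet in height, and their slopes differ from the mean slope
  \<open>W\<close> by \<open>sinh (1/2) p\<^sub>m\<close>: only the term \<open>i = m\<close> changes its branch at \<open>q m\<close>.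
\<close>

lemma branch_at_peak:
  fixes p q :: "nat \<Rightarrow> real"
  assumes m: "m \<in> {1..N}" and sm: "strict_mono_on {1..N} q"
  defines "U \<equiv> (\<Sum>j=1..N. p j * cosh (1/2 - \<bar>q j - q m\<bar>))"
    and "W \<equiv> (\<Sum>j=1..N. p j * sgn (q j - q m) * sinh (1/2 - \<bar>q j - q m\<bar>))"
  shows "branch N p q m (q m) = U" "branch N p q (m - 1) (q m) = U"
    "branch_slope N p q m (q m) = W - sinh (1/2) * p m"
    "branch_slope N p q (m - 1) (q m) = W + sinh (1/2) * p m"
proof -
  have ord: "q i < q j" if "1 \<le> i" "i < j" "j \<le> N" for i j
    using strict_mono_onD[OF sm, of i j] that by auto
  have q: "(i < m \<and> q i < q m) \<or> i = m \<or> (m < i \<and> q m < q i)" if "i \<in> {1..N}" for i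
    using ord[of i m] ord[of m i] that m by force
  have c: "cosh (1/2 - (q m - q i) - (if i \<le> m then 0 else 1)) = cosh (1/2 - \<bar>q i - q m\<bar>)"
       "cosh (1/2 - (q m - q i) - (if i \<le> m - 1 then 0 else 1)) = cosh (1/2 - \<bar>q i - q m\<bar>)"
      if "i \<in> {1..N}" for i
    using q[OF that] m cosh_minus[of "1/2 - \<bar>q i - q m\<bar>"] by auto
  show "branch N p q m (q m) = U" "branch N p q (m - 1) (q m) = U"
    unfolding branch_def U_def using c by (auto intro!: sum.cong)
  have d: "(\<Sum>i=1..N. p i * (if i = m then c else 0)) = c * p m" for c :: real
    using m by (simp add: if_distrib cong: if_cong)
  have s: "- sinh (1/2 - (q m - q i) - (if i \<le> m then 0 else 1)) =
         sgn (q i - q m) * sinh (1/2 - \<bar>q i - q m\<bar>) + (if i = m then - sinh (1/2) else 0)"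
       "- sinh (1/2 - (q m - q i) - (if i \<le> m - 1 then 0 else 1)) =
         sgn (q i - q m) * sinh (1/2 - \<bar>q i - q m\<bar>) + (if i = m then sinh (1/2) else 0)"
      if "i \<in> {1..N}" for i
    using q[OF that] m sinh_minus[of "1/2 - \<bar>q i - q m\<bar>"] sinh_minus[of "1/2::real"] by auto
  have "branch_slope N p q m (q m) = (\<Sum>i=1..N. p i * (sgn (q i - q m) * sinh (1/2 - \<bar>q i - q m\<bar>)
       + (if i = m then - sinh (1/2) else 0)))"
    unfolding branch_slope_def sum_negf[symmetric] by (intro sum.cong refl) (simp flip: s(1))
  then show "branch_slope N p q m (q m) = W - sinh (1/2) * p m"
    by (simp only: distrib_left sum.distrib d W_def) (simp add: mult.assoc)
  have "branch_slope N p q (m - 1) (q m) = (\<Sum>i=1..N. p i * (sgn (q i - q m) * sinh (1/2 - \<bar>q i - q m\<bar>)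
       + (if i = m then sinh (1/2) else 0)))"
    unfolding branch_slope_def sum_negf[symmetric] by (intro sum.cong refl) (simp flip: s(2))
  then show "branch_slope N p q (m - 1) (q m) = W + sinh (1/2) * p m"
    by (simp only: distrib_left sum.distrib d W_def) (simp add: mult.assoc)
qed

lemma branch_wraps_around:
  "branch N p q N 1 = branch N p q 0 0" "branch_slope N p q N 1 = branch_slope N p q 0 0"
  by (auto simp: branch_def branch_slope_def intro!: sum.cong)

text \<open>
  The weak form at a fixed time, after the convolution has been moved onto the test function:
  \<open>w\<close> stands for \<open>G * \<psi>\<close>, the periodic solution of \<open>w - w'' = \<psi>\<close>.  On a branch \<open>u' = v\<close> and \<open>v' = u\<close>,
  and the integrand has the primitive \<open>R = -A(u)(w - \<psi>) + B(u,v) w' + S(u,v) w\<close> with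
  \<open>A = (k\<^sub>1 + k\<^sub>2)/3 u\<^sup>3 + k\<^sub>3/2 u\<^sup>2\<close>, \<open>B = A'(u) v - k\<^sub>1/3 v\<^sup>3\<close> and
  \<open>S = k\<^sub>2/3 u\<^sup>3 - k\<^sub>2/2 u v\<^sup>2 + k\<^sub>3/2 (u\<^sup>2 - v\<^sup>2)\<close>.  The functions \<open>A\<close> and \<open>B\<close> arise from integrating
  by parts the terms with \<open>\<psi>' = (w - w'')'\<close> and \<open>\<psi> = w - w''\<close>; the coefficient of \<open>w'\<close> then fixes
  \<open>S\<close>, and the coefficient of \<open>w\<close> matches because \<open>S\<close> has derivative \<open>- k\<^sub>2/2 v\<^sup>3\<close>.  Since \<open>A\<close> does
  not involve the slope, only \<open>B\<close> and \<open>S\<close> jump at a peak: the jump of \<open>B\<close> carries the velocity and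
  the jump of \<open>S\<close> the growth rate of that peak.
\<close>

lemma multipeakon_elliptic_identity:
  fixes p q :: "nat \<Rightarrow> real" and k1 k2 k3 :: real
  assumes sm: "strict_mono_on {1..N} q"
    and q01: "\<And>i. i \<in> {1..N} \<Longrightarrow> 0 < q i \<and> q i < 1"
    and w: "\<And>x. (w has_real_derivative w' x) (at x)"
    and w': "\<And>x. (w' has_real_derivative w x - \<psi> x) (at x)"
    and \<psi>: "\<And>x. (\<psi> has_real_derivative \<psi>' x) (at x)"
    and per: "w 1 = w 0" "w' 1 = w' 0" "\<psi> 1 = \<psi> 0"
  defines "u \<equiv> peaks N p q" and "v \<equiv> slopes N p q"
  shows "((\<lambda>x. ((k1 + k2) / 3 * u x ^ 3 + k3 / 2 * u x ^ 2) * \<psi>' x + k1 / 3 * v x ^ 3 * \<psi> x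
            - (k1 / 3 + k2 / 2) * v x ^ 3 * w x
            + ((2 * k1 / 3 + k2) * u x ^ 3 + (k1 + 3 * k2 / 2) * u x * v x ^ 2
                 + k3 * u x ^ 2 + k3 / 2 * v x ^ 2) * w' x)
         has_integral 2 * sinh (1/2) *
           (\<Sum>m=1..N. p_rhs k2 k3 N p q m * w (q m) + p m * q_rhs k1 k2 k3 N p q m * w' (q m))) {0..1}"
    (is "(?h has_integral ?I) _")
proof -
  have ord: "q i < q j" if "1 \<le> i" "i < j" "j \<le> N" for i j
    using strict_mono_onD[OF sm, of i j] that by auto
  \<comment> \<open>the peak positions, completed to a partition of the unit interval\<close>
  define Q where "Q k = (if k = 0 then 0 else if k = Suc N then 1 else q k)" for k
  \<comment> \<open>these constants clear all denominators, so that ring identities suffice below\<close>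
  define a b c where "a = k1 / 3" and "b = k2 / 6" and "c = k3 / 2"
  then have kk: "k1 = 3 * a" "k2 = 6 * b" "k3 = 2 * c"
    and co: "(k1 + k2) / 3 = a + 2 * b" "k1 / 3 = a" "a + k2 / 2 = a + 3 * b"
      "2 * k1 / 3 + k2 = 2 * a + 6 * b" "k1 + 3 * k2 / 2 = 3 * a + 9 * b" by simp_all
  define A where "A u = (a + 2 * b) * u ^ 3 + c * u ^ 2" for u
  define B where "B u v = ((3 * a + 6 * b) * u ^ 2 + 2 * c * u) * v - a * v ^ 3" for u v
  define S where "S u v = 2 * b * u ^ 3 - 3 * b * u * v ^ 2 + c * (u ^ 2 - v ^ 2)" for u v
  define R where "R u v x = - A u * (w x - \<psi> x) + B u v * w' x + S u v * w x" for u v x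
  define R' where "R' u v x = A u * \<psi>' x + a * v ^ 3 * \<psi> x
            - (a + 3 * b) * v ^ 3 * w x
            + ((2 * a + 6 * b) * u ^ 3 + (3 * a + 9 * b) * u * v ^ 2
                 + 2 * c * u ^ 2 + c * v ^ 2) * w' x" for u v x
  let ?b = "branch N p q" and ?s = "branch_slope N p q"
  define P where "P k x = R (?b k x) (?s k x) x" for k x
  define P' where "P' k x = R' (?b k x) (?s k x) x" for k x
  have der: "(P k has_real_derivative P' k x) (at x)" for k x
  proof -
    define u v where "u = ?b k" and "v = ?s k"
    have u: "(u has_real_derivative v x) (at x)" and v: "(v has_real_derivative u x) (at x)"
      by (simp_all add: u_def v_def branch_derivatives)
    have dA: "((\<lambda>x. A (u x)) has_real_derivative (3 * (a + 2 * b) * u x ^ 2 + 2 * c * u x) * v x) (at x)"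
      unfolding A_def by (rule derivative_eq_intros u refl)+ (simp add: algebra_simps power2_eq_square)
    have dB: "((\<lambda>x. B (u x) (v x)) has_real_derivative
        ((6 * a + 12 * b) * u x * v x + 2 * c * v x) * v x
        + ((3 * a + 6 * b) * u x ^ 2 + 2 * c * u x) * u x - 3 * a * v x ^ 2 * u x) (at x)"
      unfolding B_def by (rule derivative_eq_intros u v refl)+ (simp add: algebra_simps power2_eq_square)
    have dS: "((\<lambda>x. S (u x) (v x)) has_real_derivative - 3 * b * v x ^ 3) (at x)"
      unfolding S_def
      by (rule derivative_eq_intros u v refl)+ (simp add: algebra_simps power2_eq_square power3_eq_cube)
    have "((\<lambda>x. R (u x) (v x) x) has_real_derivative
        - ((3 * (a + 2 * b) * u x ^ 2 + 2 * c * u x) * v x) * (w x - \<psi> x) - A (u x) * (w' x - \<psi>' x)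
        + (((6 * a + 12 * b) * u x * v x + 2 * c * v x) * v x
             + ((3 * a + 6 * b) * u x ^ 2 + 2 * c * u x) * u x - 3 * a * v x ^ 2 * u x) * w' x
        + B (u x) (v x) * (w x - \<psi> x) - 3 * b * v x ^ 3 * w x + S (u x) (v x) * w' x) (at x)"
      (is "(_ has_real_derivative ?D) _")
      unfolding R_def
      by (rule derivative_eq_intros dA dB dS w w' \<psi> refl)+ (simp add: algebra_simps)
    moreover have "?D = R' (u x) (v x) x"
      unfolding R'_def A_def B_def S_def by algebra
    ultimately show ?thesis by (simp add: P_def[abs_def] P'_def u_def v_def)
  qed
  have mono: "Q k < Q (Suc k)" if "k \<le> N" for k
    using that ord[of k "Suc k"] q01[of "k"] q01[of "Suc k"] by (auto simp: Q_def)
  have ordle: "q i \<le> q j" if "1 \<le> i" "i \<le> j" "j \<le> N" for i j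
    using ord[of i j] that by (cases "i = j") auto
  have int: "?h x = P' k x" if k: "k \<le> N" and x: "Q k < x" "x < Q (Suc k)" for k x
  proof -
    have 0: "0 < x"
      using x(1) k q01[of k] by (auto simp: Q_def split: if_splits)
    have 1: "x < 1"
      using x(2) k q01[of "Suc k"] by (auto simp: Q_def split: if_splits)
    have "q i < x" if "i \<in> {1..N}" "i \<le> k" for i
      using x(1) ordle[of i k] that k by (auto simp: Q_def split: if_splits)
    moreover have "x < q i" if "i \<in> {1..N}" "k < i" for i
      using x(2) ordle[of "Suc k" i] that k by (auto simp: Q_def split: if_splits)
    ultimately have "u x = ?b k x" "v x = ?s k x"
      unfolding u_def v_def using branch_interior[of N q x k p] q01 0 1 by blast+
    then show ?thesis by (simp only: P'_def R'_def A_def co) (simp add: kk)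
  qed
  have jump: "P m (q m) - P (m - 1) (q m) =
       - 2 * sinh (1/2) * (p_rhs k2 k3 N p q m * w (q m) + p m * q_rhs k1 k2 k3 N p q m * w' (q m))"
    if m: "m \<in> {1..N}" for m
  proof -
    note b = branch_at_peak[where p=p and q=q and N=N, OF m sm] and cl = peakon_system_closed_form[where p=p and q=q and N=N, OF m sm]
    show ?thesis
      unfolding P_def R_def b cl A_def B_def S_def kk by (simp, algebra)
  qed
  have wrap: "P N 1 = P 0 0"
    by (simp add: P_def R_def branch_wraps_around per)
  have "(?h has_integral (P N (Q (Suc N)) - P 0 (Q 0) - (\<Sum>k=1..N. P k (Q k) - P (k - 1) (Q k))))
           {Q 0..Q (Suc N)}"
    by (rule has_integral_piecewise_ftc) (use mono der int in \<open>auto intro: less_imp_le\<close>)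
  also have "(\<Sum>k=1..N. P k (Q k) - P (k - 1) (Q k)) = - ?I"
    unfolding sum_distrib_left sum_negf[symmetric]
    by (intro sum.cong refl) (use jump in \<open>auto simp: Q_def\<close>)
  finally show ?thesis using wrap by (simp add: Q_def)
qed

section \<open>Periodic functions and the Green kernel\<close>

lemma periodic1_int: "periodic1 f \<Longrightarrow> f (x + of_int n) = f x"
proof -
  assume f: "periodic1 f"
  have nat: "f (x + real m) = f x" for m x
  proof (induction m)
    case (Suc m)
    have "f (x + real (Suc m)) = f ((x + real m) + 1)" by (simp add: algebra_simps)
    then show ?case using f Suc by (simp add: periodic1_def)
  qed simp
  show ?thesis
  proof (cases "n \<ge> 0")
    case True
    then show ?thesis using nat[of x "nat n"] by simp
  next
    case False
    then show ?thesis using nat[of "x + of_int n" "nat (- n)"] by simp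
  qed
qed

lemma periodic1_frac: "periodic1 f \<Longrightarrow> f (frac x) = f x"
  using periodic1_int[of f "frac x" "\<lfloor>x\<rfloor>"] by (simp add: frac_def)

lemma continuous_bounded_unit:
  fixes f :: "real \<Rightarrow> real"
  assumes "continuous_on UNIV f"
  obtains M where "\<And>x. x \<in> {0..1} \<Longrightarrow> \<bar>f x\<bar> \<le> M"
proof -
  have "bounded (f ` {0..1})"
    by (intro compact_imp_bounded compact_continuous_image continuous_on_subset[OF assms]) auto
  then obtain M where "\<forall>y\<in>f ` {0..1}. norm y \<le> M"
    unfolding bounded_iff by blast
  then show thesis by (intro that[of M]) auto
qed

lemma periodic1_bounded:
  assumes "continuous_on UNIV f" "periodic1 f"
  obtains M where "\<And>x. \<bar>f x\<bar> \<le> M"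
proof -
  obtain M where M: "\<And>x. x \<in> {0..1} \<Longrightarrow> \<bar>f x\<bar> \<le> M"
    using continuous_bounded_unit[OF assms(1)] by blast
  have "\<bar>f x\<bar> \<le> M" for x
    using M[of "frac x"] periodic1_frac[OF assms(2), of x] by (simp add: frac_lt_1 less_imp_le)
  then show thesis by (rule that)
qed

text \<open>
  Cut the period at \<open>frac y\<close>, move the left piece one period to the right, and translate.
\<close>

lemma has_integral_periodic_shift:
  fixes f :: "real \<Rightarrow> real"
  assumes per: "periodic1 f" and f: "(f has_integral I) {0..1}"
  shows "((\<lambda>z. f (z + y)) has_integral I) {0..1}"
proof -
  define r where "r = frac y"
  have r: "0 \<le> r" "r \<le> 1" by (auto simp: r_def frac_lt_1 less_imp_le)
  have "f integrable_on {0..1}" using f by blast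
  then have "f integrable_on {0..r}" "f integrable_on {r..1}"
    using r by (auto intro: integrable_subinterval_real)
  then obtain a b where a: "(f has_integral a) {0..r}" and b: "(f has_integral b) {r..1}"
    by blast
  have "a + b = I"
    using has_integral_combine[OF r a b] f by (rule has_integral_unique)
  have "f \<circ> (+) 1 = f" using per by (auto simp: periodic1_def add.commute)
  then have "(f has_integral a) {1..1 + r}"
    using has_integral_shift_Icc_real[of f 1 a 0 r] a by (simp add: add.commute)
  then have "(f has_integral b + a) {r..1 + r}"
    using has_integral_combine[OF _ _ b, of "1 + r" a] r by simp
  then have "((f \<circ> (+) r) has_integral I) {0..1}"
    using has_integral_shift_Icc_real[of f r I 0 1] \<open>a + b = I\<close> by (simp add: add.commute)
  moreover have "(f \<circ> (+) r) z = f (z + y)" for z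
    using periodic1_int[OF per, of "z + r" "\<lfloor>y\<rfloor>"] by (simp add: r_def frac_def add.commute)
  ultimately show ?thesis by (simp add: fun_eq_iff o_def)
qed

text \<open>
  All functions of space in the weak form, apart from the convolutions, are of this kind; it makes
  the Lebesgue integral over the circle and the gauge integral over \<open>{0..1}\<close> interchangeable.
\<close>

definition bounded_borel :: "(real \<Rightarrow> real) \<Rightarrow> bool" where
  "bounded_borel f \<longleftrightarrow> f \<in> borel_measurable borel \<and> (\<exists>M. \<forall>x. \<bar>f x\<bar> \<le> M)"

lemma bounded_borelI: "f \<in> borel_measurable borel \<Longrightarrow> (\<And>x. \<bar>f x\<bar> \<le> M) \<Longrightarrow> bounded_borel f"
  by (auto simp: bounded_borel_def)

lemma bounded_borel_const: "bounded_borel (\<lambda>x. c)"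
  by (rule bounded_borelI[where M="\<bar>c\<bar>"]) auto

lemma bounded_borel_add:
  assumes "bounded_borel f" "bounded_borel g" shows "bounded_borel (\<lambda>x. f x + g x)"
proof -
  obtain A B where "\<And>x. \<bar>f x\<bar> \<le> A" "\<And>x. \<bar>g x\<bar> \<le> B" using assms by (auto simp: bounded_borel_def)
  then have "\<bar>f x + g x\<bar> \<le> A + B" for x by (meson abs_triangle_ineq add_mono order_trans)
  then show ?thesis using assms by (intro bounded_borelI) (auto simp: bounded_borel_def)
qed

lemma bounded_borel_mult:
  assumes "bounded_borel f" "bounded_borel g" shows "bounded_borel (\<lambda>x. f x * g x)"
proof -
  obtain A B where AB: "\<And>x. \<bar>f x\<bar> \<le> A" "\<And>x. \<bar>g x\<bar> \<le> B" using assms by (auto simp: bounded_borel_def)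
  then have "\<bar>f x * g x\<bar> \<le> A * B" for x
    unfolding abs_mult using order_trans[OF abs_ge_zero AB(1)] by (intro mult_mono AB) auto
  then show ?thesis using assms by (intro bounded_borelI) (auto simp: bounded_borel_def)
qed

lemma bounded_borel_power: "bounded_borel f \<Longrightarrow> bounded_borel (\<lambda>x. f x ^ n)"
  by (induction n) (auto intro: bounded_borel_const bounded_borel_mult)

lemma bounded_borel_sum: "(\<And>i. i \<in> S \<Longrightarrow> bounded_borel (f i)) \<Longrightarrow> bounded_borel (\<lambda>x. \<Sum>i\<in>S. f i x)"
  by (induction S rule: infinite_finite_induct) (auto intro: bounded_borel_const bounded_borel_add)

lemmas bounded_borel_intros =
  bounded_borel_const bounded_borel_add bounded_borel_mult bounded_borel_power bounded_borel_sum

lemma bounded_borel_periodic: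
  assumes "continuous_on UNIV f" "periodic1 f" shows "bounded_borel f"
proof -
  obtain M where "\<And>x. \<bar>f x\<bar> \<le> M" using periodic1_bounded[OF assms] by blast
  then show ?thesis by (rule bounded_borelI[OF borel_measurable_continuous_onI[OF assms(1)]])
qed

lemma bounded_borel_circle:
  assumes "bounded_borel f"
  shows "integrable circle f" "(f has_integral (LINT x|circle. f x)) {0..1}"
proof -
  from assms obtain M where f: "f \<in> borel_measurable borel" and M: "\<And>x. \<bar>f x\<bar> \<le> M"
    unfolding bounded_borel_def by blast
  interpret finite_measure circle by (rule finite_measure_lebesgue_on, rule bounded_set_imp_lmeasurable) auto
  have m: "f \<in> borel_measurable circle"
    using f by (metis borel_measurable_if_lebesgue_on measurable_completion measurable_lborel2 measurable_restrict_space1)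
  show i: "integrable circle f"
    by (rule integrable_const_bound[where B=M]) (use M m in auto)
  have "(f has_integral (LINT x|circle. f x)) {0..<1}"
    by (rule has_integral_integral_lebesgue_on[OF i]) simp
  then show "(f has_integral (LINT x|circle. f x)) {0..1}"
    by (subst has_integral_spike_set_eq[of _ "{0..<1}"]) (auto intro: negligible_subset[of "{1}"])
qed

text \<open>
  Periodic correlation with a kernel given on one period.  The kernel is evaluated at \<open>z\<close> in \<open>{0..1}\<close>
  and the shift acts on \<open>\<psi>\<close> only, so the result is as smooth as \<open>\<psi>\<close> even when the periodic extension
  of the kernel is not.
\<close>

definition average :: "(real \<Rightarrow> real) \<Rightarrow> (real \<Rightarrow> real) \<Rightarrow> real \<Rightarrow> real" where
  "average k \<psi> y = integral {0..1} (\<lambda>z. k z * \<psi> (z + y))"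

lemma borel_measurable_cosh [measurable]: "(cosh :: real \<Rightarrow> real) \<in> borel_measurable borel"
  and borel_measurable_sinh [measurable]: "(sinh :: real \<Rightarrow> real) \<in> borel_measurable borel"
  by (auto intro!: borel_measurable_continuous_onI continuous_intros)

lemma borel_measurable_frac [measurable]: "(frac :: real \<Rightarrow> real) \<in> borel_measurable borel"
  unfolding frac_def[abs_def] by measurable

lemma kernel_circle:
  fixes k \<psi> :: "real \<Rightarrow> real"
  assumes k: "continuous_on UNIV k" and \<psi>: "continuous_on UNIV \<psi>" "periodic1 \<psi>"
  shows "integrable circle (\<lambda>x. k (frac (x - y)) * \<psi> x)"
    and "(LINT x|circle. k (frac (x - y)) * \<psi> x) = average k \<psi> y"
proof -
  let ?f = "\<lambda>x. k (frac (x - y)) * \<psi> x"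
  have [measurable]: "k \<in> borel_measurable borel" "\<psi> \<in> borel_measurable borel"
    using k \<psi> by (auto intro: borel_measurable_continuous_onI)
  obtain K where K: "\<And>x. x \<in> {0..1} \<Longrightarrow> \<bar>k x\<bar> \<le> K"
    using continuous_bounded_unit[OF k] by blast
  obtain M where M: "\<And>x. \<bar>\<psi> x\<bar> \<le> M" using periodic1_bounded[OF \<psi>] by blast
  have bd: "\<bar>?f x\<bar> \<le> K * M" for x
    unfolding abs_mult using K[of 0]
    by (intro mult_mono K M) (auto simp: frac_lt_1 less_imp_le)
  have meas: "?f \<in> borel_measurable borel" by measurable
  note bb = bounded_borelI[OF meas bd]
  show "integrable circle ?f" by (rule bounded_borel_circle[OF bb])
  have "(\<lambda>z. k z * \<psi> (z + y)) integrable_on {0..1}"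
    by (intro integrable_continuous_interval continuous_intros continuous_on_subset[OF k]
        continuous_on_compose2[OF \<psi>(1)]) auto
  then have "((\<lambda>z. k z * \<psi> (z + y)) has_integral average k \<psi> y) {0..1}"
    unfolding average_def by (rule integrable_integral)
  then have "((\<lambda>z. ?f (z + y)) has_integral average k \<psi> y) {0..1}"
    by (rule has_integral_spike_finite[where S="{1}", rotated 2]) (auto simp: frac_eq)
  moreover have "periodic1 (\<lambda>z. ?f (z + y))"
  proof -
    have "frac (x + 1) = frac x" for x :: real by (simp add: frac_1_eq)
    then show ?thesis using \<psi>(2) by (auto simp: periodic1_def) (metis add.commute add.left_commute)
  qed
  ultimately have "((\<lambda>z. ?f ((z + - y) + y)) has_integral average k \<psi> y) {0..1}"
    using has_integral_periodic_shift[of "\<lambda>z. ?f (z + y)" _ "- y"] by simp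
  then have "(?f has_integral average k \<psi> y) {0..1}" by simp
  then show "(LINT x|circle. ?f x) = average k \<psi> y"
    using bounded_borel_circle(2)[OF bb] by (rule has_integral_unique[symmetric])
qed

text \<open>
  Pairing a kernel with corner or jump at the moving point \<open>y t\<close> against a smooth function is
  differentiable in time: in moving coordinates only the smooth function depends on \<open>t\<close>.
\<close>

lemma average_has_derivative:
  fixes \<phi> D1 D2 :: "real \<times> real \<Rightarrow> real" and y y' k :: "real \<Rightarrow> real"
  assumes k: "continuous_on UNIV k"
    and \<phi>: "\<And>z. (\<phi> has_derivative (\<lambda>h. D1 z * fst h + D2 z * snd h)) (at z)"
    and D: "continuous_on UNIV D1" "continuous_on UNIV D2"
    and U: "convex U" "t \<in> U"
    and y: "\<And>t. t \<in> U \<Longrightarrow> (y has_real_derivative y' t) (at t within U)"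
    and y': "continuous_on U y'"
  shows "((\<lambda>t. average k (\<lambda>x. \<phi> (t, x)) (y t)) has_real_derivative
           average k (\<lambda>x. D1 (t, x)) (y t) + y' t * average k (\<lambda>x. D2 (t, x)) (y t)) (at t within U)"
proof -
  have cy: "continuous_on U y"
    using y by (meson DERIV_continuous_on)
  have c\<phi>: "continuous_on UNIV \<phi>"
    using \<phi> by (auto intro!: continuous_at_imp_continuous_on has_derivative_continuous)
  have der: "((\<lambda>t. k z * \<phi> (t, z + y t)) has_real_derivative
      k z * (D1 (s, z + y s) + y' s * D2 (s, z + y s))) (at s within U)" if "s \<in> U" for s z
  proof -
    have "((\<lambda>t. (t, z + y t)) has_derivative (\<lambda>h. (h, 0 + y' s * h))) (at s within U)"
      by (intro derivative_intros y[OF that, unfolded has_field_derivative_def])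
    from has_derivative_compose[OF this \<phi>]
    have "((\<lambda>t. \<phi> (t, z + y t)) has_real_derivative D1 (s, z + y s) + y' s * D2 (s, z + y s)) (at s within U)"
      unfolding has_field_derivative_def
      by (rule has_derivative_eq_rhs) (auto simp: algebra_simps)
    then show ?thesis by (auto intro!: derivative_eq_intros)
  qed
  have int: "(\<lambda>z. k z * f (s, z + y s)) integrable_on cbox 0 1" if "continuous_on UNIV f"
    for f :: "real \<times> real \<Rightarrow> real" and s
    by (intro integrable_continuous continuous_intros continuous_on_subset[OF k]
        continuous_on_compose2[OF that]) auto
  have cont: "continuous_on (U \<times> cbox 0 1) (\<lambda>(s, z). k z * (D1 (s, z + y s) + y' s * D2 (s, z + y s)))"
    unfolding case_prod_beta
    by (intro continuous_intros continuous_on_compose2[OF k] continuous_on_compose2[OF D(1)]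
        continuous_on_compose2[OF D(2)] continuous_on_compose2[OF cy] continuous_on_compose2[OF y']) auto
  have "((\<lambda>t. integral (cbox 0 1) (\<lambda>z. k z * \<phi> (t, z + y t))) has_real_derivative
      integral (cbox 0 1) (\<lambda>z. k z * (D1 (t, z + y t) + y' t * D2 (t, z + y t)))) (at t within U)"
    by (rule leibniz_rule_field_derivative[OF der int[OF c\<phi>] cont U(2,1)])
  also have "integral (cbox 0 1) (\<lambda>z. k z * (D1 (t, z + y t) + y' t * D2 (t, z + y t)))
     = integral (cbox 0 1) (\<lambda>z. k z * D1 (t, z + y t) + y' t * (k z * D2 (t, z + y t)))"
    by (simp add: algebra_simps)
  also have "\<dots> = integral (cbox 0 1) (\<lambda>z. k z * D1 (t, z + y t))
       + y' t * integral (cbox 0 1) (\<lambda>z. k z * D2 (t, z + y t))"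
    using int[OF D(1), of t] int[OF D(2), of t]
    by (subst integral_add) (auto intro: integrable_on_mult_right)
  finally show ?thesis by (simp add: average_def)
qed

lemma continuous_on_average:
  fixes \<phi> :: "real \<times> real \<Rightarrow> real"
  assumes k: "continuous_on UNIV k" and \<phi>: "continuous_on UNIV \<phi>" and y: "continuous_on U y"
  shows "continuous_on U (\<lambda>t. average k (\<lambda>x. \<phi> (t, x)) (y t))"
proof -
  have "continuous_on (U \<times> cbox 0 1) (\<lambda>(s, z). k z * \<phi> (s, z + y s))"
    unfolding case_prod_beta
    by (intro continuous_intros continuous_on_compose2[OF k] continuous_on_compose2[OF \<phi>]
        continuous_on_compose2[OF y]) auto
  from integral_continuous_on_param[OF this] show ?thesis by (simp add: average_def)
qed

text \<open>
  The case of a function independent of time, with \<open>y t = t\<close>.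
\<close>

lemma average_space_derivative:
  fixes \<psi> \<psi>' k :: "real \<Rightarrow> real"
  assumes k: "continuous_on UNIV k"
    and \<psi>: "\<And>x. (\<psi> has_real_derivative \<psi>' x) (at x)" and c: "continuous_on UNIV \<psi>'"
  shows "(average k \<psi> has_real_derivative average k \<psi>' y) (at y)"
proof -
  have "((\<lambda>t. average k (\<lambda>x. \<psi> (snd (t, x))) t) has_real_derivative
      average k (\<lambda>x. (\<lambda>_. 0) (y, x)) y + 1 * average k (\<lambda>x. \<psi>' (snd (y, x))) y) (at y within UNIV)"
  proof (rule average_has_derivative[OF k, where \<phi>="\<lambda>z. \<psi> (snd z)" and ?D1.0="\<lambda>_. 0"
        and ?D2.0="\<lambda>z. \<psi>' (snd z)" and y="\<lambda>t. t" and y'="\<lambda>_. 1"])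
    show "((\<lambda>z. \<psi> (snd z)) has_derivative (\<lambda>h. 0 * fst h + \<psi>' (snd z) * snd h)) (at z)" for z :: "real \<times> real"
      using has_derivative_compose[OF has_derivative_snd[OF has_derivative_ident] \<psi>[unfolded has_field_derivative_def], of z UNIV]
      by simp
    show "continuous_on UNIV (\<lambda>z::real \<times> real. \<psi>' (snd z))"
      by (intro continuous_on_compose2[OF c] continuous_intros) auto
  qed (auto intro: derivative_eq_intros)
  moreover have "average k (\<lambda>x. 0) y = 0" by (simp add: average_def)
  ultimately show ?thesis by simp
qed

abbreviation cosh_average where "cosh_average \<equiv> average (\<lambda>z. cosh (1/2 - z))"
abbreviation sinh_average where "sinh_average \<equiv> average (\<lambda>z. sinh (1/2 - z))"

text \<open>
  Integration by parts over one period: \<open>cosh (1/2 - z)\<close> takes equal values at \<open>0\<close> and \<open>1\<close>, while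
  \<open>sinh (1/2 - z)\<close> changes sign and leaves a boundary term.  Together the two identities say that
  \<open>cosh_average \<psi> / (2 sinh (1/2))\<close> solves \<open>w - w'' = \<psi>\<close>.
\<close>

lemma average_by_parts:
  fixes \<psi> \<psi>' :: "real \<Rightarrow> real"
  assumes \<psi>: "\<And>x. (\<psi> has_real_derivative \<psi>' x) (at x)" and c: "continuous_on UNIV \<psi>'" and per: "periodic1 \<psi>"
  shows "cosh_average \<psi>' y = sinh_average \<psi> y"
    and "sinh_average \<psi>' y = cosh_average \<psi> y - 2 * sinh (1/2) * \<psi> y"
proof -
  have c0: "continuous_on UNIV \<psi>"
    using \<psi> by (meson DERIV_isCont continuous_at_imp_continuous_on)
  have sh: "((\<lambda>z. \<psi> (z + y)) has_real_derivative \<psi>' (z + y)) (at z)" for z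
    using \<psi>[of "z + y"] by (simp add: DERIV_shift)
  have p1: "\<psi> (1 + y) = \<psi> y" using per unfolding periodic1_def by (metis add.commute)
  have int: "(\<lambda>z. k (1/2 - z) * f (z + y)) integrable_on {0..1}"
    if "continuous_on UNIV f" "continuous_on UNIV k" for f k :: "real \<Rightarrow> real"
    by (intro integrable_continuous_interval continuous_intros
        continuous_on_compose2[OF that(1)] continuous_on_compose2[OF that(2)]) auto
  have cc: "continuous_on UNIV (cosh :: real \<Rightarrow> real)" "continuous_on UNIV (sinh :: real \<Rightarrow> real)"
    by (auto intro!: continuous_intros)
  have m: "cosh (- (1/2)) = (cosh (1/2) :: real)" "sinh (- (1/2)) = - (sinh (1/2) :: real)"
    by (rule cosh_minus sinh_minus)+
  have "((\<lambda>z. cosh (1/2 - z) * \<psi>' (z + y) - sinh (1/2 - z) * \<psi> (z + y)) has_integral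
      cosh (1/2 - 1) * \<psi> (1 + y) - cosh (1/2 - 0) * \<psi> (0 + y)) {0..1}"
    by (rule fundamental_theorem_of_calculus)
      (auto simp: has_real_derivative_iff_has_vector_derivative[symmetric]
        intro!: derivative_eq_intros sh intro: has_field_derivative_at_within)
  then have "integral {0..1} (\<lambda>z. cosh (1/2 - z) * \<psi>' (z + y) - sinh (1/2 - z) * \<psi> (z + y)) = 0"
    using p1 m by (simp add: integral_unique)
  then show "cosh_average \<psi>' y = sinh_average \<psi> y"
    using integral_diff[OF int[OF c cc(1)] int[OF c0 cc(2)]] by (simp add: average_def)
  have "((\<lambda>z. sinh (1/2 - z) * \<psi>' (z + y) - cosh (1/2 - z) * \<psi> (z + y)) has_integral
      sinh (1/2 - 1) * \<psi> (1 + y) - sinh (1/2 - 0) * \<psi> (0 + y)) {0..1}"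
    by (rule fundamental_theorem_of_calculus)
      (auto simp: has_real_derivative_iff_has_vector_derivative[symmetric]
        intro!: derivative_eq_intros sh intro: has_field_derivative_at_within)
  then have "integral {0..1} (\<lambda>z. sinh (1/2 - z) * \<psi>' (z + y) - cosh (1/2 - z) * \<psi> (z + y)) = - 2 * sinh (1/2) * \<psi> y"
    using p1 m by (simp add: integral_unique)
  then show "sinh_average \<psi>' y = cosh_average \<psi> y - 2 * sinh (1/2) * \<psi> y"
    using integral_diff[OF int[OF c cc(2)] int[OF c0 cc(1)]] by (simp add: average_def)
qed

lemma G_frac: "G x = cosh (1/2 - frac x) / (2 * sinh (1/2))"
  using cosh_minus[of "1/2 - frac x"] by (simp add: G_def)

text \<open>
  Fubini for the bounded kernel \<open>G (x - y)\<close>; the inner integral over \<open>x\<close> is a \<open>cosh\<close>-average because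
  \<open>G x\<close> is a multiple of \<open>cosh (1/2 - frac x)\<close>.
\<close>

lemma conv_G_duality:
  fixes C \<psi> :: "real \<Rightarrow> real"
  assumes "bounded_borel C"
    and \<psi>: "continuous_on UNIV \<psi>" "periodic1 \<psi>"
  shows "integrable circle (\<lambda>x. conv G C x * \<psi> x)"
    and "(LINT x|circle. conv G C x * \<psi> x) = (LINT y|circle. C y * (cosh_average \<psi> y / (2 * sinh (1/2))))"
proof -
  from assms(1) obtain M where C: "C \<in> borel_measurable borel" "\<And>x. \<bar>C x\<bar> \<le> M"
    unfolding bounded_borel_def by blast
  interpret finite_measure circle by (rule finite_measure_lebesgue_on, rule bounded_set_imp_lmeasurable) auto
  interpret P: pair_sigma_finite circle circle ..
  interpret F: finite_measure "circle \<Otimes>\<^sub>M circle"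
    by (rule finite_measure_pair_measure) unfold_locales
  let ?f = "\<lambda>(x, y). G (x - y) * C y * \<psi> x"
  have bm: "f \<in> borel_measurable circle" if "f \<in> borel_measurable borel" for f :: "real \<Rightarrow> real"
    using that by (metis borel_measurable_if_lebesgue_on measurable_completion measurable_lborel2 measurable_restrict_space1)
  note [measurable] = C(1)
  have [measurable]: "\<psi> \<in> borel_measurable borel"
    using \<psi> by (auto intro: borel_measurable_continuous_onI)
  have [measurable]: "G \<in> borel_measurable borel" unfolding G_def[abs_def] by measurable
  \<comment> \<open>the product is formed with the completed measure, so measurability passes through Borel functions\<close>
  have id: "(\<lambda>x. x) \<in> circle \<rightarrow>\<^sub>M borel" by (rule bm) simp
  have mf: "fst \<in> circle \<Otimes>\<^sub>M circle \<rightarrow>\<^sub>M borel" "snd \<in> circle \<Otimes>\<^sub>M circle \<rightarrow>\<^sub>M borel"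
    by (rule measurable_compose[OF measurable_fst id] measurable_compose[OF measurable_snd id])+
  have meas: "?f \<in> borel_measurable (circle \<Otimes>\<^sub>M circle)"
    unfolding case_prod_beta using mf by measurable
  obtain K where K: "\<And>x. \<bar>\<psi> x\<bar> \<le> K" using periodic1_bounded[OF \<psi>] by blast
  define L where "L = cosh (1/2) / (2 * sinh (1/2) :: real)"
  have GL: "\<bar>G x\<bar> \<le> L" for x
  proof -
    have "\<bar>1/2 - frac x\<bar> \<le> 1/2" using frac_ge_0[of x] frac_lt_1[of x] 
      unfolding abs_le_iff by linarith
    then have "cosh \<bar>1/2 - frac x\<bar> \<le> cosh (1/2)"
      by (subst cosh_real_nonneg_le_iff) auto
    then show ?thesis by (simp add: G_frac L_def divide_right_mono abs_mult)
  qed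
  have "norm (?f z) \<le> L * M * K" for z
  proof -
    have "\<bar>G (fst z - snd z) * C (snd z) * \<psi> (fst z)\<bar> \<le> L * M * K"
      unfolding abs_mult using GL[of 0] C(2)[of 0] K[of 0]
      by (intro mult_mono GL C K) (auto intro: order_trans[OF abs_ge_zero])
    then show ?thesis by (simp add: case_prod_beta)
  qed
  then have i: "integrable (circle \<Otimes>\<^sub>M circle) ?f"
    by (intro F.integrable_const_bound[where B="L * M * K"] meas) auto
  have e: "(LINT y|circle. ?f (x, y)) = conv G C x * \<psi> x" for x
    by (simp add: conv_def)
  show "integrable circle (\<lambda>x. conv G C x * \<psi> x)"
    using P.integrable_fst'[OF i] unfolding e .
  have g: "(LINT x|circle. ?f (x, y)) = C y * (cosh_average \<psi> y / (2 * sinh (1/2)))" for y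
  proof -
    have "(LINT x|circle. ?f (x, y)) = (LINT x|circle. C y / (2 * sinh (1/2)) * (cosh (1/2 - frac (x - y)) * \<psi> x))"
      by (simp add: G_frac mult_ac)
    also have "\<dots> = C y / (2 * sinh (1/2)) * cosh_average \<psi> y"
      by (simp only: integral_mult_right_zero, subst kernel_circle(2)[where k="\<lambda>z. cosh (1/2 - z)"])
        (auto intro!: continuous_intros \<psi>)
    finally show ?thesis by simp
  qed
  show "(LINT x|circle. conv G C x * \<psi> x) = (LINT y|circle. C y * (cosh_average \<psi> y / (2 * sinh (1/2))))"
    using P.Fubini_integral[of "\<lambda>x y. ?f (x, y)"] i unfolding e g by simp
qed

section \<open>Regularity of multi-peakons\<close>

lemma bounded_borel_peaks: "bounded_borel (peaks N p q)" and bounded_borel_slopes: "bounded_borel (slopes N p q)"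
proof -
  have *: "bounded_borel (\<lambda>x. f (1/2 - frac (x - y)))" if f: "continuous_on UNIV f" for f :: "real \<Rightarrow> real" and y
  proof -
    have [measurable]: "f \<in> borel_measurable borel" using f by (rule borel_measurable_continuous_onI)
    have "continuous_on UNIV (\<lambda>x. f (1/2 - x))"
      by (intro continuous_on_compose2[OF f] continuous_intros) auto
    then obtain M where M: "\<And>x. x \<in> {0..1} \<Longrightarrow> \<bar>f (1/2 - x)\<bar> \<le> M"
      using continuous_bounded_unit by blast
    show ?thesis
      by (rule bounded_borelI[where M=M], measurable) (auto intro!: M simp: frac_lt_1 less_imp_le)
  qed
  show "bounded_borel (peaks N p q)"
    unfolding peaks_def[abs_def] by (intro bounded_borel_intros *) (auto intro!: continuous_intros)
  have "bounded_borel (\<lambda>x. (-1) * (\<Sum>i=1..N. p i * sinh (1/2 - frac (x - q i))))"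
    by (intro bounded_borel_intros *) (auto intro!: continuous_intros)
  then show "bounded_borel (slopes N p q)"
    unfolding slopes_def[abs_def] by simp
qed

text \<open>
  Each peak is a translate of the periodic extension of the \<open>cosh\<close> kernel, so pairings with the wave
  are values of averages at the peak positions; likewise for the slope and the \<open>sinh\<close> kernel.
\<close>

lemma peaks_pairing:
  assumes \<psi>: "continuous_on UNIV \<psi>" "periodic1 \<psi>"
  shows "(LINT x|circle. peaks N p q x * \<psi> x) = (\<Sum>i=1..N. p i * cosh_average \<psi> (q i))"
    and "(LINT x|circle. slopes N p q x * \<psi> x) = - (\<Sum>i=1..N. p i * sinh_average \<psi> (q i))"
proof -
  have c: "continuous_on UNIV (\<lambda>z::real. cosh (1/2 - z))" "continuous_on UNIV (\<lambda>z::real. sinh (1/2 - z))"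
    by (auto intro!: continuous_intros)
  note k = kernel_circle[OF c(1) \<psi>] kernel_circle[OF c(2) \<psi>]
  have "(LINT x|circle. peaks N p q x * \<psi> x) =
      (LINT x|circle. (\<Sum>i=1..N. p i * (cosh (1/2 - frac (x - q i)) * \<psi> x)))"
    by (simp add: peaks_def sum_distrib_right mult.assoc)
  also have "\<dots> = (\<Sum>i=1..N. p i * cosh_average \<psi> (q i))"
    by (subst Bochner_Integration.integral_sum) (auto simp: k)
  finally show "(LINT x|circle. peaks N p q x * \<psi> x) = (\<Sum>i=1..N. p i * cosh_average \<psi> (q i))" .
  have "(LINT x|circle. slopes N p q x * \<psi> x) =
      (LINT x|circle. - (\<Sum>i=1..N. p i * (sinh (1/2 - frac (x - q i)) * \<psi> x)))"
    by (simp add: slopes_def sum_distrib_right mult.assoc)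
  also have "\<dots> = - (\<Sum>i=1..N. p i * sinh_average \<psi> (q i))"
    unfolding integral_minus by (subst Bochner_Integration.integral_sum) (auto simp: k)
  finally show "(LINT x|circle. slopes N p q x * \<psi> x) = - (\<Sum>i=1..N. p i * sinh_average \<psi> (q i))" .
qed

lemma C_inf_real:
  fixes \<psi> :: "real \<Rightarrow> real"
  assumes "C_inf \<psi>"
  shows "(\<psi> has_real_derivative deriv \<psi> x) (at x)" and "continuous_on UNIV (deriv \<psi>)"
proof -
  have "C_k (Suc 0) \<psi>" using assms by (simp only: C_inf_def)
  then have d: "\<And>x. \<psi> differentiable (at x)" and c: "continuous_on UNIV (\<lambda>x. frechet_derivative \<psi> (at x) 1)"
    by auto
  then have r: "(\<psi> has_real_derivative deriv \<psi> x) (at x)" for x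
    by (metis DERIV_deriv_iff_real_differentiable)
  show "(\<psi> has_real_derivative deriv \<psi> x) (at x)" by (rule r)
  have "frechet_derivative \<psi> (at x) 1 = deriv \<psi> x" for x
    using frechet_derivative_at[OF r[of x, unfolded has_field_derivative_def]] by (metis mult.right_neutral)
  then show "continuous_on UNIV (deriv \<psi>)" using c by simp
qed

text \<open>
  Iterated directional derivatives are turned into a total derivative with continuous partial
  derivatives, the form required for differentiation along the curves \<open>(t, q t)\<close>.
\<close>

lemma C_inf_plane:
  fixes \<phi> :: "real \<times> real \<Rightarrow> real"
  assumes "C_inf \<phi>"
  obtains D1 D2 where
    "\<And>z. (\<phi> has_derivative (\<lambda>h. D1 z * fst h + D2 z * snd h)) (at z)"
    "continuous_on UNIV D1" "continuous_on UNIV D2"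
    "\<And>t x. ((\<lambda>s. \<phi> (s, x)) has_real_derivative D1 (t, x)) (at t)"
    "\<And>t x. ((\<lambda>y. \<phi> (t, y)) has_real_derivative D2 (t, x)) (at x)"
proof -
  define D1 where "D1 z = frechet_derivative \<phi> (at z) (1, 0)" for z
  define D2 where "D2 z = frechet_derivative \<phi> (at z) (0, 1)" for z
  have "C_k (Suc 0) \<phi>" using assms by (simp only: C_inf_def)
  then have d: "\<And>z. \<phi> differentiable (at z)" and c: "continuous_on UNIV D1" "continuous_on UNIV D2"
    by (auto simp: D1_def[abs_def] D2_def[abs_def])
  have h: "(\<phi> has_derivative (\<lambda>h. D1 z * fst h + D2 z * snd h)) (at z)" for z
  proof -
    have f: "(\<phi> has_derivative frechet_derivative \<phi> (at z)) (at z)"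
      using d[of z] by (simp add: frechet_derivative_works)
    interpret l: linear "frechet_derivative \<phi> (at z)"
      using f by (rule has_derivative_linear)
    have "frechet_derivative \<phi> (at z) h = D1 z * fst h + D2 z * snd h" for h
    proof -
      have "frechet_derivative \<phi> (at z) h
          = frechet_derivative \<phi> (at z) (fst h *\<^sub>R (1, 0) + snd h *\<^sub>R (0, 1))"
        by (cases h) simp
      also have "\<dots> = fst h * D1 z + snd h * D2 z"
        by (simp only: l.add l.scale D1_def D2_def real_scaleR_def)
      finally show ?thesis by simp
    qed
    then have "frechet_derivative \<phi> (at z) = (\<lambda>h. D1 z * fst h + D2 z * snd h)" by (rule ext)
    with f show ?thesis by simp
  qed
  show thesis
  proof (rule that[of D1 D2])
    fix t x :: real
    have "((\<lambda>s. (s, x)) has_derivative (\<lambda>h. (h, 0))) (at t)"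
      by (intro derivative_intros)
    from has_derivative_compose[OF this h]
    show "((\<lambda>s. \<phi> (s, x)) has_real_derivative D1 (t, x)) (at t)"
      by (simp add: has_field_derivative_def)
    have "((\<lambda>y. (t, y)) has_derivative (\<lambda>h. (0, h))) (at x)"
      by (intro derivative_intros)
    from has_derivative_compose[OF this h]
    show "((\<lambda>y. \<phi> (t, y)) has_real_derivative D2 (t, x)) (at x)"
      by (simp add: has_field_derivative_def)
  qed (use h c in auto)
qed

text \<open>
  No boundary terms arise at the peaks because the \<open>cosh\<close> kernel is continuous on the circle.
\<close>

lemma peaks_weak_deriv: "has_weak_deriv (peaks N p q) (slopes N p q)"
  unfolding has_weak_deriv_def
proof (intro allI impI, elim conjE)
  fix \<psi> :: "real \<Rightarrow> real" assume \<psi>: "C_inf \<psi>" "periodic1 \<psi>"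
  note d = C_inf_real[OF \<psi>(1)]
  have c: "continuous_on UNIV \<psi>" using d(1) by (meson DERIV_isCont continuous_at_imp_continuous_on)
  have p: "periodic1 (deriv \<psi>)"
    unfolding periodic1_def
  proof
    fix x
    have "(\<lambda>x. \<psi> (x + 1)) = \<psi>" using \<psi>(2) by (auto simp: periodic1_def)
    then have "(\<psi> has_real_derivative deriv \<psi> (x + 1)) (at x)"
      using d(1)[of "x + 1"] by (simp add: DERIV_shift)
    then show "deriv \<psi> (x + 1) = deriv \<psi> x" using d(1) DERIV_unique by blast
  qed
  show "(LINT x|circle. peaks N p q x * deriv \<psi> x) = - (LINT x|circle. slopes N p q x * \<psi> x)"
    unfolding peaks_pairing[OF d(2) p] peaks_pairing[OF c \<psi>(2)]
    using average_by_parts(1)[OF d \<psi>(2)] by simp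
qed

lemma bounded_borel_L3:
  assumes f: "bounded_borel f" "periodic1 f" and M: "\<And>x. \<bar>f x\<bar> \<le> M"
  shows "f \<in> L3" "L3_norm f \<le> M"
proof -
  interpret finite_measure circle by (rule finite_measure_lebesgue_on, rule bounded_set_imp_lmeasurable) auto
  have i: "integrable circle f" by (rule bounded_borel_circle(1)[OF f(1)])
  have "bounded_borel (\<lambda>x. \<bar>f x\<bar>)"
    using f(1) unfolding bounded_borel_def abs_abs by (intro conjI borel_measurable_abs) blast+
  then have i3: "integrable circle (\<lambda>x. \<bar>f x\<bar> ^ 3)"
    by (intro bounded_borel_circle(1) bounded_borel_intros)
  show "f \<in> L3" using f i i3 by (auto simp: L3_def)
  have M0: "0 \<le> M" using M[of 0] by (meson abs_ge_zero order_trans)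
  have "(LINT x|circle. \<bar>f x\<bar> ^ 3) \<le> (LINT x|circle. M ^ 3)"
    by (rule integral_mono[OF i3]) (auto intro!: power_mono M)
  also have "\<dots> = M ^ 3" by (simp add: measure_restrict_space)
  finally have "L3_norm f \<le> root 3 (M ^ 3)"
    unfolding L3_norm_def by simp
  then show "L3_norm f \<le> M" using M0 by (simp add: real_root_power_cancel)
qed

lemma periodic1_peaks: "periodic1 (peaks N p q)" and periodic1_slopes: "periodic1 (slopes N p q)"
proof -
  have "frac (x + 1 - y) = frac (x - y)" for x y :: real
    using frac_1_eq[of "x - y"] by (simp add: algebra_simps)
  then show "periodic1 (peaks N p q)" "periodic1 (slopes N p q)"
    by (simp_all add: periodic1_def peaks_def slopes_def)
qed

lemma peaks_bound: "\<bar>peaks N p q x\<bar> \<le> (\<Sum>i=1..N. \<bar>p i\<bar>) * cosh (1/2)"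
  and slopes_bound: "\<bar>slopes N p q x\<bar> \<le> (\<Sum>i=1..N. \<bar>p i\<bar>) * cosh (1/2)"
proof -
  have f: "\<bar>1/2 - frac (x - q i)\<bar> \<le> 1/2" for i
    using frac_ge_0[of "x - q i"] frac_lt_1[of "x - q i"] unfolding abs_le_iff by linarith
  have c: "cosh \<bar>1/2 - frac (x - q i)\<bar> \<le> cosh (1/2)" for i
    using f[of i] by (subst cosh_real_nonneg_le_iff) auto
  have s: "\<bar>sinh y\<bar> \<le> cosh y" for y :: real
    using cosh_plus_sinh[of y] cosh_minus_sinh[of y] exp_gt_zero[of y] exp_gt_zero[of "- y"]
    by (intro abs_leI) linarith+
  show "\<bar>peaks N p q x\<bar> \<le> (\<Sum>i=1..N. \<bar>p i\<bar>) * cosh (1/2)"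
    unfolding peaks_def sum_distrib_right
    by (rule order_trans[OF sum_abs], rule sum_mono) (use c in \<open>auto simp: abs_mult intro!: mult_left_mono\<close>)
  have "\<bar>sinh (1/2 - frac (x - q i))\<bar> \<le> cosh (1/2)" for i
    using s[of "1/2 - frac (x - q i)"] c[of i] by simp
  then show "\<bar>slopes N p q x\<bar> \<le> (\<Sum>i=1..N. \<bar>p i\<bar>) * cosh (1/2)"
    unfolding slopes_def sum_distrib_right abs_minus_cancel
    by (intro order_trans[OF sum_abs] sum_mono) (auto simp: abs_mult intro!: mult_left_mono)
qed

lemma peaks_W13: "peaks N p q \<in> W13"
  unfolding W13_def using peaks_weak_deriv[of N p q]
    bounded_borel_L3(1)[OF bounded_borel_peaks periodic1_peaks peaks_bound]
    bounded_borel_L3(1)[OF bounded_borel_slopes periodic1_slopes slopes_bound] by blast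

lemma time_interval_borel: "time_interval T \<in> sets borel"
proof -
  have "open {t. ereal t < T}" by (intro open_Collect_less continuous_intros)
  then have "{0..} \<inter> {t. ereal t < T} \<in> sets borel" by auto
  moreover have "time_interval T = {0..} \<inter> {t. ereal t < T}" by (auto simp: time_interval_def)
  ultimately show ?thesis by simp
qed

lemma convex_time_interval: "convex (time_interval T)"
proof -
  have "is_interval (time_interval T)"
    unfolding is_interval_1 time_interval_def
    by (auto intro: order_trans le_less_trans[of "ereal _" "ereal _"])
  then show ?thesis by (rule is_interval_convex)
qed

text \<open>
  The \<open>L\<^sup>3\<close> norms at time \<open>t\<close> are controlled by the sum of the \<open>\<bar>p i t\<bar>\<close>, which is bounded on compact
  time intervals.
\<close>

lemma moving_peaks_Linf_loc_W13:
  assumes p: "\<And>i. i \<in> {1..N} \<Longrightarrow> continuous_on (time_interval T) (p i)"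
    and q: "\<And>i. i \<in> {1..N} \<Longrightarrow> continuous_on (time_interval T) (q i)"
  shows "Linf_loc_W13 T (\<lambda>t. peaks N (\<lambda>i. p i t) (\<lambda>i. q i t)) (\<lambda>t. slopes N (\<lambda>i. p i t) (\<lambda>i. q i t))"
proof -
  let ?I = "time_interval T"
  let ?L = "lebesgue_on (?I \<times> (UNIV :: real set))"
  have sets: "?I \<times> (UNIV :: real set) \<in> sets lebesgue"
    using borel_Times[OF time_interval_borel, of UNIV T] by (intro sets_completionI_sets) simp
  have c: "f \<in> borel_measurable ?L" if "continuous_on (?I \<times> UNIV) f" for f :: "real \<times> real \<Rightarrow> real"
    by (rule continuous_imp_measurable_on_sets_lebesgue[OF that sets])
  have mp: "(\<lambda>z. p i (fst z)) \<in> borel_measurable ?L" if "i \<in> {1..N}" for i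
    by (intro c continuous_on_compose2[OF p[OF that]] continuous_intros) auto
  have mq: "(\<lambda>z. frac (snd z - q i (fst z))) \<in> borel_measurable ?L" if "i \<in> {1..N}" for i
    by (rule measurable_compose[OF c borel_measurable_frac],
        intro continuous_intros continuous_on_compose2[OF q[OF that]]) auto
  have m: "(\<lambda>z. p i (fst z) * f (1/2 - frac (snd z - q i (fst z)))) \<in> borel_measurable ?L"
    if i: "i \<in> {1..N}" and f: "f \<in> borel_measurable borel" for i and f :: "real \<Rightarrow> real"
    by (intro borel_measurable_times mp[OF i] measurable_compose[OF _ f] borel_measurable_diff
        borel_measurable_const mq[OF i])
  have 1: "(\<lambda>(t, x). peaks N (\<lambda>i. p i t) (\<lambda>i. q i t) x) \<in> borel_measurable ?L"
    unfolding peaks_def case_prod_beta by (intro borel_measurable_sum m) auto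
  have 2: "(\<lambda>(t, x). slopes N (\<lambda>i. p i t) (\<lambda>i. q i t) x) \<in> borel_measurable ?L"
    unfolding slopes_def case_prod_beta by (intro borel_measurable_uminus borel_measurable_sum m) auto
  have 3: "\<exists>C. \<forall>t\<in>{0..\<tau>}. L3_norm (peaks N (\<lambda>i. p i t) (\<lambda>i. q i t)) + L3_norm (slopes N (\<lambda>i. p i t) (\<lambda>i. q i t)) \<le> C"
    if \<tau>: "\<tau> \<in> ?I" for \<tau>
  proof -
    have sub: "{0..\<tau>} \<subseteq> ?I" using \<tau> by (auto simp: time_interval_def intro: le_less_trans[of "ereal _" "ereal _"])
    have "continuous_on {0..\<tau>} (\<lambda>t. \<Sum>i=1..N. \<bar>p i t\<bar>)"
      by (intro continuous_intros continuous_on_subset[OF p sub])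
    then have "bounded ((\<lambda>t. \<Sum>i=1..N. \<bar>p i t\<bar>) ` {0..\<tau>})"
      by (intro compact_imp_bounded compact_continuous_image) auto
    then obtain M where "\<forall>y\<in>(\<lambda>t. \<Sum>i=1..N. \<bar>p i t\<bar>) ` {0..\<tau>}. norm y \<le> M"
      unfolding bounded_iff by blast
    then have M: "(\<Sum>i=1..N. \<bar>p i t\<bar>) \<le> M" if "t \<in> {0..\<tau>}" for t
      using that by (force intro: order_trans[OF abs_ge_self])
    have "L3_norm (peaks N (\<lambda>i. p i t) (\<lambda>i. q i t)) + L3_norm (slopes N (\<lambda>i. p i t) (\<lambda>i. q i t))
        \<le> M * cosh (1/2) + M * cosh (1/2)" if t: "t \<in> {0..\<tau>}" for t
    proof -
      have le: "(\<Sum>i=1..N. \<bar>p i t\<bar>) * cosh (1/2) \<le> M * cosh (1/2)"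
        using M[OF t] by (intro mult_right_mono) auto
      show ?thesis
        by (intro add_mono bounded_borel_L3(2) bounded_borel_peaks bounded_borel_slopes periodic1_peaks periodic1_slopes
            order_trans[OF peaks_bound le] order_trans[OF slopes_bound le])
    qed
    then show ?thesis by blast
  qed
  show ?thesis
    unfolding Linf_loc_W13_def
  proof (intro conjI ballI 1 2)
    show "AE t in lebesgue_on ?I. peaks N (\<lambda>i. p i t) (\<lambda>i. q i t) \<in> L3 \<and>
        slopes N (\<lambda>i. p i t) (\<lambda>i. q i t) \<in> L3 \<and>
        has_weak_deriv (peaks N (\<lambda>i. p i t) (\<lambda>i. q i t)) (slopes N (\<lambda>i. p i t) (\<lambda>i. q i t))"
      using bounded_borel_L3(1)[OF bounded_borel_peaks periodic1_peaks peaks_bound]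
        bounded_borel_L3(1)[OF bounded_borel_slopes periodic1_slopes slopes_bound] peaks_weak_deriv by simp
    fix \<tau> assume "\<tau> \<in> ?I"
    from 3[OF this] obtain C where C: "\<And>t. t \<in> {0..\<tau>} \<Longrightarrow>
      L3_norm (peaks N (\<lambda>i. p i t) (\<lambda>i. q i t)) + L3_norm (slopes N (\<lambda>i. p i t) (\<lambda>i. q i t)) \<le> C" by blast
    show "\<exists>C. AE t in lebesgue_on {0..\<tau>}. L3_norm (peaks N (\<lambda>i. p i t) (\<lambda>i. q i t))
        + L3_norm (slopes N (\<lambda>i. p i t) (\<lambda>i. q i t)) \<le> C"
      by (rule exI[of _ C], rule AE_I2) (use C in simp)
  qed
qed

section \<open>The weak formulation\<close>

lemma multipeakon_eq_peaks: "multipeakon N p q t = peaks N (\<lambda>i. p i t) (\<lambda>i. q i t)"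
  by (auto simp: multipeakon_def peaks_def frac_def algebra_simps)

lemma periodic1_average:
  assumes "periodic1 \<psi>" shows "periodic1 (average k \<psi>)"
proof -
  have "\<psi> (z + (x + 1)) = \<psi> (z + x)" for z x
    using assms unfolding periodic1_def by (metis add.assoc)
  then show ?thesis by (simp add: periodic1_def average_def)
qed

text \<open>
  The elliptic identity expressed through averages of the test function.  With \<open>\<eta>\<close>, \<open>\<psi>\<close>, \<open>\<psi>'\<close> the
  slices of \<open>\<phi>\<^sub>t\<close>, \<open>\<phi>\<close>, \<open>\<phi>\<^sub>x\<close> and with the dynamical system, the right-hand side is the time derivative
  of the pairing of the wave with \<open>\<phi>\<close>.
\<close>

lemma spatial_weak_form:
  fixes p q :: "nat \<Rightarrow> real" and \<eta> \<psi> \<psi>' :: "real \<Rightarrow> real"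
  assumes sm: "strict_mono_on {1..N} q" and q01: "\<And>i. i \<in> {1..N} \<Longrightarrow> 0 < q i \<and> q i < 1"
    and \<eta>: "continuous_on UNIV \<eta>" "periodic1 \<eta>"
    and \<psi>: "\<And>x. (\<psi> has_real_derivative \<psi>' x) (at x)" "periodic1 \<psi>"
    and \<psi>': "continuous_on UNIV \<psi>'" "periodic1 \<psi>'"
  defines "u \<equiv> peaks N p q" and "v \<equiv> slopes N p q"
  shows "(LINT x|circle.
              u x * \<eta> x
            + (k1 + k2) / 3 * (u x) ^ 3 * \<psi>' x
            + k1 / 3 * (v x) ^ 3 * \<psi> x
            + k3 / 2 * (u x) ^ 2 * \<psi>' x
            - conv G (\<lambda>y. (k1 / 3 + k2 / 2) * (v y) ^ 3) x * \<psi> x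
            + conv G (\<lambda>y. (2 * k1 / 3 + k2) * (u y) ^ 3
                        + (k1 + 3 * k2 / 2) * u y * (v y) ^ 2
                        + k3 * (u y) ^ 2 + k3 / 2 * (v y) ^ 2) x
                * \<psi>' x)
       = (\<Sum>m=1..N. p m * cosh_average \<eta> (q m)
           + p_rhs k2 k3 N p q m * cosh_average \<psi> (q m)
           + p m * (q_rhs k1 k2 k3 N p q m * cosh_average \<psi>' (q m)))"
proof -
  let ?C = "\<lambda>y. (k1 / 3 + k2 / 2) * (v y) ^ 3"
  let ?F = "\<lambda>y. (2 * k1 / 3 + k2) * (u y) ^ 3 + (k1 + 3 * k2 / 2) * u y * (v y) ^ 2
                        + k3 * (u y) ^ 2 + k3 / 2 * (v y) ^ 2"
  let ?s = "2 * sinh (1/2) :: real"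
  have s0: "sinh (1/2 :: real) > 0" by simp
  \<comment> \<open>the potential \<open>G * \<psi>\<close> and its derivative\<close>
  define w where "w y = cosh_average \<psi> y / ?s" for y
  define w' where "w' y = cosh_average \<psi>' y / ?s" for y
  have kc: "continuous_on UNIV (\<lambda>z::real. cosh (1/2 - z))" "continuous_on UNIV (\<lambda>z::real. sinh (1/2 - z))"
    by (auto intro!: continuous_intros)
  have c\<psi>: "continuous_on UNIV \<psi>" using \<psi>(1) by (meson DERIV_isCont continuous_at_imp_continuous_on)
  have w: "(w has_real_derivative w' x) (at x)" for x
    unfolding w_def[abs_def] w'_def
    by (intro DERIV_cdivide average_space_derivative[OF kc(1) \<psi>(1) \<psi>'(1)])
  have "w' = (\<lambda>y. sinh_average \<psi> y / ?s)"
    using average_by_parts(1)[OF \<psi>(1) \<psi>'(1) \<psi>(2)] by (auto simp: w'_def)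
  then have "(w' has_real_derivative sinh_average \<psi>' x / ?s) (at x)" for x
    by (simp only:) (intro DERIV_cdivide average_space_derivative[OF kc(2) \<psi>(1) \<psi>'(1)])
  moreover have "sinh_average \<psi>' x / ?s = w x - \<psi> x" for x
    using average_by_parts(2)[OF \<psi>(1) \<psi>'(1) \<psi>(2)] s0 by (simp add: w_def diff_divide_distrib)
  ultimately have w': "(w' has_real_derivative w x - \<psi> x) (at x)" for x by simp
  have pw: "periodic1 w" "periodic1 w'"
    using periodic1_average[OF \<psi>(2)] periodic1_average[OF \<psi>'(2)]
    by (auto simp: periodic1_def w_def w'_def)
  have "continuous_on UNIV w" "continuous_on UNIV w'"
    using w w' by (meson DERIV_isCont continuous_at_imp_continuous_on)+
  then have bw: "bounded_borel w" "bounded_borel w'" using pw by (auto intro: bounded_borel_periodic)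
  have b\<psi>: "bounded_borel \<eta>" "bounded_borel \<psi>" "bounded_borel \<psi>'"
    using \<eta> \<psi>' c\<psi> \<psi>(2) by (auto intro: bounded_borel_periodic)
  have buv: "bounded_borel u" "bounded_borel v"
    by (auto simp: u_def v_def bounded_borel_peaks bounded_borel_slopes)
  have bCF: "bounded_borel ?C" "bounded_borel ?F"
    by (intro bounded_borel_intros buv)+
  let ?f1 = "\<lambda>x. u x * \<eta> x"
  let ?f2 = "\<lambda>x. ((k1 + k2) / 3 * u x ^ 3 + k3 / 2 * u x ^ 2) * \<psi>' x + k1 / 3 * v x ^ 3 * \<psi> x"
  have i1: "integrable circle ?f1" and i2: "integrable circle ?f2"
    and iC: "integrable circle (\<lambda>x. ?C x * w x)" and iF: "integrable circle (\<lambda>x. ?F x * w' x)"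
    by (intro bounded_borel_circle(1) bounded_borel_intros buv b\<psi> bw)+
  note dC = conv_G_duality[OF bCF(1) c\<psi> \<psi>(2)] and dF = conv_G_duality[OF bCF(2) \<psi>']
  have "(LINT x|circle.
              u x * \<eta> x
            + (k1 + k2) / 3 * (u x) ^ 3 * \<psi>' x
            + k1 / 3 * (v x) ^ 3 * \<psi> x
            + k3 / 2 * (u x) ^ 2 * \<psi>' x
            - conv G ?C x * \<psi> x + conv G ?F x * \<psi>' x)
      = (LINT x|circle. ?f1 x + ?f2 x - conv G ?C x * \<psi> x + conv G ?F x * \<psi>' x)"
    by (intro Bochner_Integration.integral_cong refl) (simp add: algebra_simps)
  also have "\<dots> = (LINT x|circle. ?f1 x) + (LINT x|circle. ?f2 x)
      - (LINT x|circle. conv G ?C x * \<psi> x) + (LINT x|circle. conv G ?F x * \<psi>' x)"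
    using i1 i2 dC(1) dF(1) by simp
  also have "\<dots> = (LINT x|circle. ?f1 x) + ((LINT x|circle. ?f2 x)
      - (LINT x|circle. ?C x * w x) + (LINT x|circle. ?F x * w' x))"
    unfolding dC(2) dF(2) w_def w'_def by simp
  also have "(LINT x|circle. ?f2 x) - (LINT x|circle. ?C x * w x) + (LINT x|circle. ?F x * w' x)
      = ?s * (\<Sum>m=1..N. p_rhs k2 k3 N p q m * w (q m) + p m * q_rhs k1 k2 k3 N p q m * w' (q m))"
  proof (rule has_integral_unique)
    show "((\<lambda>x. ?f2 x - ?C x * w x + ?F x * w' x) has_integral
        (LINT x|circle. ?f2 x) - (LINT x|circle. ?C x * w x) + (LINT x|circle. ?F x * w' x)) {0..1}"
      by (intro has_integral_add has_integral_diff bounded_borel_circle(2) bounded_borel_intros buv b\<psi> bw)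
    have p1: "w 1 = w 0" "w' 1 = w' 0" "\<psi> 1 = \<psi> 0"
      using pw \<psi>(2) unfolding periodic1_def by (metis add_0)+
    show "((\<lambda>x. ?f2 x - ?C x * w x + ?F x * w' x) has_integral
        ?s * (\<Sum>m=1..N. p_rhs k2 k3 N p q m * w (q m) + p m * q_rhs k1 k2 k3 N p q m * w' (q m))) {0..1}"
      using multipeakon_elliptic_identity[where p=p and ?k1.0=k1 and ?k2.0=k2 and ?k3.0=k3,
          OF sm _ w w' \<psi>(1) p1] q01
      by (simp add: u_def v_def)
  qed
  also have "\<dots> = (\<Sum>m=1..N. p_rhs k2 k3 N p q m * cosh_average \<psi> (q m)
           + p m * (q_rhs k1 k2 k3 N p q m * cosh_average \<psi>' (q m)))"
    unfolding sum_distrib_left w_def w'_def using s0 by (intro sum.cong refl) (simp add: field_simps)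
  also have "(LINT x|circle. ?f1 x) = (\<Sum>m=1..N. p m * cosh_average \<eta> (q m))"
    unfolding u_def by (rule peaks_pairing(1)[OF \<eta>])
  finally show ?thesis by (simp add: sum.distrib add.assoc)
qed

text \<open>
  The fundamental theorem of calculus on \<open>[0,T)\<close> for a function that vanishes after time \<open>\<tau>\<close>.  The
  integration takes place on \<open>[0,\<sigma>]\<close> for some \<open>\<sigma>\<close> strictly between \<open>\<tau>\<close> and \<open>T\<close>, so that \<open>D \<sigma> = 0\<close> holds
  by hypothesis.
\<close>

lemma integral_time_interval:
  fixes D D' :: "real \<Rightarrow> real"
  assumes D: "\<And>t. t \<in> time_interval T \<Longrightarrow> (D has_real_derivative D' t) (at t within time_interval T)"
    and D': "continuous_on (time_interval T) D'"
    and \<tau>: "\<tau> \<in> time_interval T" "\<And>t. \<tau> < t \<Longrightarrow> t \<in> time_interval T \<Longrightarrow> D t = 0"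
  shows "(LINT t|lebesgue_on (time_interval T). D' t) = - D 0"
proof -
  let ?I = "time_interval T"
  obtain \<sigma> where \<sigma>: "ereal \<tau> < ereal \<sigma>" "ereal \<sigma> < T"
    using \<tau>(1) ereal_dense2[of "ereal \<tau>" T] by (auto simp: time_interval_def)
  have \<tau>0: "0 \<le> \<tau>" using \<tau>(1) by (simp add: time_interval_def)
  have \<sigma>I: "\<sigma> \<in> ?I" using \<sigma> \<tau>0 by (simp add: time_interval_def)
  have sub: "{0..\<sigma>} \<subseteq> ?I"
    using \<sigma>(2) by (auto simp: time_interval_def intro: le_less_trans[of "ereal _" "ereal \<sigma>"])
  have zero: "D' t = 0" if t: "\<tau> < t" "t \<in> ?I" for t
  proof -
    obtain \<rho> where \<rho>: "ereal t < ereal \<rho>" "ereal \<rho> < T"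
      using t(2) ereal_dense2[of "ereal t" T] by (auto simp: time_interval_def)
    have sub': "{\<tau><..<\<rho>} \<subseteq> ?I"
      using \<rho>(2) \<tau>0 by (auto simp: time_interval_def intro: less_trans[of "ereal _" "ereal \<rho>"])
    have "(D has_real_derivative D' t) (at t within {\<tau><..<\<rho>})"
      using D[OF t(2)] sub' by (rule DERIV_subset)
    then have 1: "(D has_real_derivative D' t) (at t)"
      using t \<rho> by (subst (asm) at_within_open) auto
    have "((\<lambda>_. 0) has_real_derivative D' t) (at t)"
      by (rule has_field_derivative_transform_within_open[OF 1, of "{\<tau><..<\<rho>}"])
        (use t \<rho> sub' \<tau>(2) in auto)
    then show ?thesis using DERIV_unique DERIV_const by blast
  qed
  have "(D' has_integral D \<sigma> - D 0) {0..\<sigma>}"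
  proof (rule fundamental_theorem_of_calculus)
    show "0 \<le> \<sigma>" using \<sigma> \<tau>0 by simp
    show "(D has_vector_derivative D' t) (at t within {0..\<sigma>})" if "t \<in> {0..\<sigma>}" for t
      using DERIV_subset[OF D sub, of t] that sub
      by (auto simp: has_real_derivative_iff_has_vector_derivative)
  qed
  then have "integral {0..\<sigma>} D' = - D 0"
    using \<tau>(2)[of \<sigma>] \<sigma> \<sigma>I by (simp add: integral_unique)
  moreover have "set_integrable lebesgue {0..\<sigma>} D'"
    by (rule absolutely_integrable_continuous_real[OF continuous_on_subset[OF D' sub]])
  ultimately have L: "(LINT t:{0..\<sigma>}|lebesgue. D' t) = - D 0"
    by (simp add: set_lebesgue_integral_eq_integral)
  have ind: "indicator {0..\<sigma>} t *\<^sub>R D' t = indicator ?I t *\<^sub>R D' t" for t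
  proof (cases "t \<in> ?I")
    case True
    then have "0 \<le> t" by (simp add: time_interval_def)
    then show ?thesis using True zero[of t] \<sigma>(1) by (auto simp: indicator_def)
  qed (use sub in \<open>auto simp: indicator_def\<close>)
  have "?I \<in> sets lebesgue"
    using time_interval_borel by (intro sets_completionI_sets) simp
  then have I: "?I \<inter> space lebesgue \<in> sets lebesgue" by simp
  show ?thesis
    unfolding integral_restrict_space[OF I] ind[symmetric]
    using L unfolding set_lebesgue_integral_def .
qed

theorem proposition1p4:
  fixes k1 k2 k3 :: real and N :: nat and T :: ereal
    and p q p' q' :: "nat \<Rightarrow> real \<Rightarrow> real"
  assumes "N \<ge> 1" and "T > 0"
    and "\<And>t. t \<in> time_interval T \<Longrightarrow> 0 < q 1 t"
    and "\<And>t i j. t \<in> time_interval T \<Longrightarrow> 1 \<le> i \<Longrightarrow> i < j \<Longrightarrow> j \<le> N \<Longrightarrow> q i t < q j t"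
    and "\<And>t. t \<in> time_interval T \<Longrightarrow> q N t < 1"
    and "\<And>m t. m \<in> {1..N} \<Longrightarrow> t \<in> time_interval T \<Longrightarrow>
           (p m has_real_derivative p' m t) (at t within time_interval T)"
    and "\<And>m t. m \<in> {1..N} \<Longrightarrow> t \<in> time_interval T \<Longrightarrow>
           (q m has_real_derivative q' m t) (at t within time_interval T)"
    and "\<And>m. m \<in> {1..N} \<Longrightarrow> continuous_on (time_interval T) (p' m)"
    and "\<And>m. m \<in> {1..N} \<Longrightarrow> continuous_on (time_interval T) (q' m)"
    and "\<And>m t. m \<in> {1..N} \<Longrightarrow> t \<in> time_interval T \<Longrightarrow>
           p' m t = p_rhs k2 k3 N (\<lambda>i. p i t) (\<lambda>i. q i t) m"
    and "\<And>m t. m \<in> {1..N} \<Longrightarrow> t \<in> time_interval T \<Longrightarrow>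
           q' m t = q_rhs k1 k2 k3 N (\<lambda>i. p i t) (\<lambda>i. q i t) m"
  shows "weak_solution k1 k2 k3 T (multipeakon N p q 0) (multipeakon N p q)"
proof -
  let ?I = "time_interval T"
  note q_first = assms(3) and q_less = assms(4) and q_last = assms(5)
    and dp = assms(6) and dq = assms(7) and cp' = assms(8) and cq' = assms(9)
    and p_eq = assms(10) and q_eq = assms(11)
  have cp: "continuous_on ?I (p m)" and cq: "continuous_on ?I (q m)" if "m \<in> {1..N}" for m
    using dp[OF that] dq[OF that] by (meson DERIV_continuous_on)+
  have sm: "strict_mono_on {1..N} (\<lambda>i. q i t)" if "t \<in> ?I" for t
    by (rule strict_mono_onI) (use q_less[OF that] in auto)
  have q01: "0 < q i t \<and> q i t < 1" if "t \<in> ?I" "i \<in> {1..N}" for t i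
    using q_first[OF that(1)] q_last[OF that(1)] q_less[OF that(1), of 1 i] q_less[OF that(1), of i N] that(2)
    by (cases "i = 1"; cases "i = N") auto
  let ?u = "\<lambda>t. peaks N (\<lambda>i. p i t) (\<lambda>i. q i t)"
  let ?v = "\<lambda>t. slopes N (\<lambda>i. p i t) (\<lambda>i. q i t)"
  have kc: "continuous_on UNIV (\<lambda>z::real. cosh (1/2 - z))" by (auto intro!: continuous_intros)
  have weak: "(LINT t|lebesgue_on ?I. LINT x|circle.
              ?u t x * deriv (\<lambda>s. \<phi> (s, x)) t
            + (k1 + k2) / 3 * (?u t x) ^ 3 * deriv (\<lambda>y. \<phi> (t, y)) x
            + k1 / 3 * (?v t x) ^ 3 * \<phi> (t, x)
            + k3 / 2 * (?u t x) ^ 2 * deriv (\<lambda>y. \<phi> (t, y)) x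
            - conv G (\<lambda>y. (k1 / 3 + k2 / 2) * (?v t y) ^ 3) x * \<phi> (t, x)
            + conv G (\<lambda>y. (2 * k1 / 3 + k2) * (?u t y) ^ 3
                        + (k1 + 3 * k2 / 2) * ?u t y * (?v t y) ^ 2
                        + k3 * (?u t y) ^ 2 + k3 / 2 * (?v t y) ^ 2) x
                * deriv (\<lambda>y. \<phi> (t, y)) x)
          + (LINT x|circle. ?u 0 x * \<phi> (0, x)) = 0"
    (is "(LINT t|lebesgue_on ?I. LINT x|circle. ?W t x) + _ = 0")
    if \<phi>: "\<phi> \<in> test_functions T" for \<phi>
  proof -
    from \<phi> have smooth: "C_inf \<phi>" and per: "\<And>t. periodic1 (\<lambda>x. \<phi> (t, x))"
      by (auto simp: test_functions_def)
    from \<phi> obtain \<tau> where \<tau>: "\<tau> \<in> ?I" "\<And>t x. \<tau> < t \<Longrightarrow> \<phi> (t, x) = 0"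
      by (auto simp: test_functions_def)
    obtain D1 D2 where D: "\<And>z. (\<phi> has_derivative (\<lambda>h. D1 z * fst h + D2 z * snd h)) (at z)"
      "continuous_on UNIV D1" "continuous_on UNIV D2"
      and D1: "\<And>t x. ((\<lambda>s. \<phi> (s, x)) has_real_derivative D1 (t, x)) (at t)"
      and D2: "\<And>t x. ((\<lambda>y. \<phi> (t, y)) has_real_derivative D2 (t, x)) (at x)"
      using C_inf_plane[OF smooth] by blast
    have c\<phi>: "continuous_on UNIV \<phi>"
      using D(1) by (auto intro!: continuous_at_imp_continuous_on has_derivative_continuous)
    have slice: "continuous_on UNIV (\<lambda>x. f (t, x))" if "continuous_on UNIV f" for f :: "real \<times> real \<Rightarrow> real" and t
      by (intro continuous_on_compose2[OF that] continuous_intros) auto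
    have per1: "periodic1 (\<lambda>x. D1 (t, x))" for t
      unfolding periodic1_def
    proof
      fix x
      have "(\<lambda>s. \<phi> (s, x + 1)) = (\<lambda>s. \<phi> (s, x))" using per by (auto simp: periodic1_def)
      then show "D1 (t, x + 1) = D1 (t, x)"
        using D1[of "x + 1" t] D1[of x t] DERIV_unique by metis
    qed
    have per2: "periodic1 (\<lambda>x. D2 (t, x))" for t
      unfolding periodic1_def
    proof
      fix x
      have "(\<lambda>y. \<phi> (t, y + 1)) = (\<lambda>y. \<phi> (t, y))" using per[of t] by (auto simp: periodic1_def)
      moreover have "((\<lambda>y. \<phi> (t, y + 1)) has_real_derivative D2 (t, x + 1)) (at x)"
        using D2[of t "x + 1"] by (simp only: DERIV_shift)
      ultimately have "((\<lambda>y. \<phi> (t, y)) has_real_derivative D2 (t, x + 1)) (at x)"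
        by (simp only:)
      then show "D2 (t, x + 1) = D2 (t, x)" using D2[of t x] DERIV_unique by blast
    qed
    define c0 c1 c2 where "c0 m t = cosh_average (\<lambda>x. \<phi> (t, x)) (q m t)"
      and "c1 m t = cosh_average (\<lambda>x. D1 (t, x)) (q m t)"
      and "c2 m t = cosh_average (\<lambda>x. D2 (t, x)) (q m t)" for m t
    \<comment> \<open>the pairing of the wave at time \<open>t\<close> with the test function\<close>
    define E where "E t = (\<Sum>m=1..N. p m t * c0 m t)" for t
    define E' where "E' t = (\<Sum>m=1..N. p m t * c1 m t + p' m t * c0 m t + p m t * (q' m t * c2 m t))" for t
    have W: "(LINT x|circle. ?W t x) = E' t" if t: "t \<in> ?I" for t
    proof -
      have d: "deriv (\<lambda>s. \<phi> (s, x)) t = D1 (t, x)" "deriv (\<lambda>y. \<phi> (t, y)) x = D2 (t, x)" for x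
        using D1 D2 by (auto intro: DERIV_imp_deriv)
      show ?thesis
        unfolding d
        by (subst spatial_weak_form[OF sm[OF t] q01[OF t] slice[OF D(2)] per1 D2 per slice[OF D(3)] per2])
          (auto simp: E'_def c0_def c1_def c2_def p_eq[OF _ t] q_eq[OF _ t] intro!: sum.cong)
    qed
    have dc0: "(c0 m has_real_derivative c1 m t + q' m t * c2 m t) (at t within ?I)"
      if "m \<in> {1..N}" "t \<in> ?I" for m t
      unfolding c0_def[abs_def] c1_def c2_def
      by (rule average_has_derivative[OF kc D convex_time_interval that(2) dq[OF that(1)] cq'[OF that(1)]])
    have dE: "(E has_real_derivative E' t) (at t within ?I)" if t: "t \<in> ?I" for t
      unfolding E_def[abs_def] E'_def
    proof (rule DERIV_sum)
      fix m assume m: "m \<in> {1..N}"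
      show "((\<lambda>t. p m t * c0 m t) has_real_derivative
          p m t * c1 m t + p' m t * c0 m t + p m t * (q' m t * c2 m t)) (at t within ?I)"
        by (rule DERIV_cong[OF DERIV_mult[OF dp[OF m t] dc0[OF m t]]]) (simp add: algebra_simps)
    qed
    have cE': "continuous_on ?I E'"
      unfolding E'_def[abs_def] c0_def c1_def c2_def
      by (intro continuous_intros cp cp' cq' continuous_on_average[OF kc] c\<phi> D cq)
    have E0: "E t = 0" if "\<tau> < t" for t
      using \<tau>(2)[OF that] by (simp add: E_def c0_def average_def)
    have "(LINT t|lebesgue_on ?I. LINT x|circle. ?W t x) = (LINT t|lebesgue_on ?I. E' t)"
      by (intro Bochner_Integration.integral_cong refl W) simp
    also have "\<dots> = - E 0"
      by (rule integral_time_interval[OF dE cE' \<tau>(1) E0])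
    also have "E 0 = (LINT x|circle. ?u 0 x * \<phi> (0, x))"
      by (simp add: E_def c0_def peaks_pairing(1)[OF slice[OF c\<phi>] per])
    finally show ?thesis by simp
  qed
  show ?thesis
    unfolding weak_solution_def multipeakon_eq_peaks
  proof (intro conjI exI[of _ ?v] ballI)
    show "?u 0 \<in> W13" by (rule peaks_W13)
    show "Linf_loc_W13 T ?u ?v"
      by (rule moving_peaks_Linf_loc_W13) (use cp cq in auto)
  qed (rule weak)
qed

end
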